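(* Consider the RIS-aided MIMO channel $\mathbf G=\sqrt{\beta_{\mathrm t}\beta_{\mathrm r}}\mathbf R\boldsymbol\Phi\mathbf T+\sqrt{\beta_{\mathrm d}}\mathbf H$ described in the context, with $N_{\mathrm t}>N_{\mathrm r}$, and let $C=\mathbb E\{\log_2\det(\mathbf I_{N_{\mathrm r}}+\bar\rho\,\mathbf G\mathbf G^{\dagger})\}$ with $\bar\rho=\rho/N_{\mathrm t}$, $\rho>0$. Then $$C\le\log_2\Big(\sum_{t=0}^{N_{\mathrm r}}\bar\rho^{\,t}\sum_{\mathcal Q\subseteq\{1,\dots,N_{\mathrm t}\},\,|\mathcal Q|=t}\det(\boldsymbol\Psi_{\mathcal Q})\,\mathsf J_{N_{\mathrm r}}\big(\tilde\theta_1,\dots,\tilde\theta_{L_{\mathcal Q}}\big)\frac{(N_{\mathrm r}-L_{\mathcal Q})!}{(N_{\mathrm r}-t)!}\Big),$$ where for each $\mathcal Q$, $\tilde\theta_1,\dots,\tilde\theta_{L_{\mathcal Q}}$ are the non-zero eigenvalues of $\boldsymbol\Psi_{\mathcal Q}^{-1}\boldsymbol\Sigma_{\mathcal Q}$ with $\boldsymbol\Sigma=\bar{\mathbf G}^{\dagger}\bar{\mathbf G}$.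
   Context: Setup: $N_{\mathrm t},N_{\mathrm r},M=M_{\mathrm h}M_{\mathrm v}$ positive integers; $\mathbf T\in\mathbb C^{M\times N_{\mathrm t}}$, $\bar{\mathbf R}\in\mathbb C^{N_{\mathrm r}\times M}$, $\bar{\mathbf H}\in\mathbb C^{N_{\mathrm r}\times N_{\mathrm t}}$ are line-of-sight matrices of the form $\mathbf T=\sum_{i=1}^{P_{\mathbf T}}\frac{t_i}{\sqrt{P_{\mathbf T}}}\mathbf a_{M_{\mathrm h},M_{\mathrm v}}(\varphi_{a_1,i},\theta_{a_1,i})\mathbf a_{N_{\mathrm t}}(\theta_{d_1,i})^\intercal$, $\bar{\mathbf R}=\sum_{i=1}^{P_{\mathbf R}}\frac{r_i}{\sqrt{P_{\mathbf R}}}\mathbf a_{N_{\mathrm r}}(\theta_{a_2,i})\mathbf a_{M_{\mathrm h},M_{\mathrm v}}(\varphi_{d_2,i},\theta_{d_2,i})^\intercal$, $\bar{\mathbf H}=\sum_{i=1}^{P_{\mathbf H}}\frac{h_i}{\sqrt{P_{\mathbf H}}}\mathbf a_{N_{\mathrm r}}(\theta_{a_3,i})\mathbf a_{N_{\mathrm t}}(\theta_{d_3,i})^\intercal$, where $\mathbf a_N(\theta)=[e^{\mathsf j2\pi(n-1)\frac{d}{\lambda}\sin\theta}]_{n=1}^{N}$ (column; $d=d_{\mathrm t}$ for $N_{\mathrm t}$, $d=d_{\mathrm r}$ for $N_{\mathrm r}$) and $\mathbf a_{M_{\mathrm h},M_{\mathrm v}}(\varphi,\theta)^\intercal=[e^{\mathsf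 j2\pi(m-1)\frac{d_{\mathrm v}}{\lambda}\sin\theta}]_{m=1}^{M_{\mathrm v}}\otimes[e^{\mathsf j2\pi(n-1)\frac{d_{\mathrm h}}{\lambda}\cos\theta\sin\varphi}]_{n=1}^{M_{\mathrm h}}$. The gains $t_i,r_i,h_i$ (i.i.d. $\mathcal{CN}(0,1)$ in the model) and all angles are treated as fixed (the result is conditional on them). $\boldsymbol\Phi=\mathrm{diag}\{e^{\mathsf j\theta_1},\dots,e^{\mathsf j\theta_M}\}$ is fixed. $\beta_{\mathrm t},\beta_{\mathrm r},\beta_{\mathrm d}>0$; $L_{\mathbf R}+N_{\mathbf R}=1$, $L_{\mathbf H}+N_{\mathbf H}=1$, all $\ge0$, and $N_{\mathbf H}>0$. $\mathbf R=\sqrt{L_{\mathbf R}}\bar{\mathbf R}+\sqrt{N_{\mathbf R}}\tilde{\mathbf R}$, $\mathbf H=\sqrt{L_{\mathbf H}}\bar{\mathbf H}+\sqrt{N_{\mathbf H}}\tilde{\mathbf H}$ with $\tilde{\mathbf R},\tilde{\mathbf H}$ independent with i.i.d. $\mathcal{CN}(0,1)$ entries; the expectation is over $\tilde{\mathbf R},\tilde{\mathbf H}$. Define $\bar{\mathbf G}=\sqrt{\beta_{\mathrm t}\beta_{\mathrm r}L_{\mathbf R}}\bar{\mathbf R}\boldsymbol\Phi\mathbf T+\sqrt{\beta_{\mathrm d}L_{\mathbf H}}\bar{\mathbf H}$ and $\boldsymbol\Psi=\beta_{\mathrm t}\beta_{\mathrm r}N_{\mathbf R}\mathbf T^{\dagger}\mathbf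 T+\beta_{\mathrm d}N_{\mathbf H}\mathbf I_{N_{\mathrm t}}$. For a square matrix $\mathbf A$ and index set $\mathcal Q$, $\mathbf A_{\mathcal Q}$ is the principal submatrix with rows and columns indexed by $\mathcal Q$ (for $\mathcal Q=\emptyset$ its determinant is $1$). For an integer $q$ and numbers $\theta_1,\dots,\theta_L$: $\mathsf J_q(\theta_1,\dots,\theta_L)=\det(\boldsymbol\Delta)/V(\theta_1,\dots,\theta_L)$, where $\boldsymbol\Delta\in\mathbb C^{L\times L}$ has $(i,j)$ entry $(q-L+j+\theta_i)\theta_i^{j-1}$ and $V(\theta_1,\dots,\theta_L)=\prod_{i<j\le L}(\theta_j-\theta_i)$; $\mathsf J_q=1$ when $L=0$, and when eigenvalues coincide the ratio is understood as its limit. *)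

theory Defs
  imports "HOL-Probability.Probability"
    "Jordan_Normal_Form.Char_Poly"
    "Jordan_Normal_Form.Schur_Decomposition"
    "Jordan_Normal_Form.DL_Submatrix"
    "Jordan_Normal_Form.Gauss_Jordan_Elimination"
begin

(* Indices are 0-based throughout: entry n of a length-N vector corresponds to the
   paper's index n+1; path index i < P corresponds to the paper's i+1. *)

definition steer :: "nat \<Rightarrow> real \<Rightarrow> real \<Rightarrow> real \<Rightarrow> complex vec" where
  "steer N d lam th = vec N (\<lambda>n. exp (\<i> * complex_of_real (2 * pi * real n * d / lam * sin th)))"

(* UPA steering vector a_{Mh,Mv}(phi,theta) = [vertical] (Kronecker) [horizontal];
   Kronecker index k = m * Mh + n with m < Mv, n < Mh *)
definition steer2 :: "nat \<Rightarrow> nat \<Rightarrow> real \<Rightarrow> real \<Rightarrow> real \<Rightarrow> real \<Rightarrow> real \<Rightarrow> complex vec" where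
  "steer2 Mh Mv dh dv lam ph th = vec (Mh * Mv) (\<lambda>k.
      exp (\<i> * complex_of_real (2 * pi * real (k div Mh) * dv / lam * sin th)) *
      exp (\<i> * complex_of_real (2 * pi * real (k mod Mh) * dh / lam * cos th * sin ph)))"

definition los_mat :: "nat \<Rightarrow> nat \<Rightarrow> nat \<Rightarrow> (nat \<Rightarrow> complex) \<Rightarrow> (nat \<Rightarrow> complex vec)
    \<Rightarrow> (nat \<Rightarrow> complex vec) \<Rightarrow> complex mat" where
  "los_mat nr nc P g u w = mat nr nc (\<lambda>(k, l).
      \<Sum>i<P. g i / complex_of_real (sqrt (real P)) * (u i $ k) * (w i $ l))"

definition CN_measure :: "complex measure" where
  "CN_measure = density lborel (\<lambda>z. ennreal (exp (- (cmod z)\<^sup>2) / pi))"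

definition gauss_mat :: "nat \<Rightarrow> nat \<Rightarrow> (nat \<times> nat \<Rightarrow> complex) measure" where
  "gauss_mat n m = PiM ({..<n} \<times> {..<m}) (\<lambda>_. CN_measure)"

definition to_mat :: "nat \<Rightarrow> nat \<Rightarrow> (nat \<times> nat \<Rightarrow> complex) \<Rightarrow> complex mat" where
  "to_mat n m f = mat n m (\<lambda>(i, j). f (i, j))"

definition J_ratio :: "int \<Rightarrow> nat \<Rightarrow> (nat \<Rightarrow> complex) \<Rightarrow> complex" where
  "J_ratio q L x =
     Determinant.det (mat L L (\<lambda>(i, j). (of_int q - of_nat L + of_nat (j + 1) + x i) * x i ^ j))
     / (\<Prod>(i, j) \<in> {(i, j). i < j \<and> j < L}. x j - x i)"

definition J_fun :: "int \<Rightarrow> complex list \<Rightarrow> complex" where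
  "J_fun q ths =
     (let L = length ths; x = (\<lambda>i. if i < L then ths ! i else 0) in
      if distinct ths then J_ratio q L x
      else Lim (at x within {y. inj_on y {..<L} \<and> (\<forall>i\<ge>L. y i = 0)}) (J_ratio q L))"

(* J applied to a multiset of arguments (J is symmetric in its arguments) *)
definition J_mset :: "int \<Rightarrow> complex multiset \<Rightarrow> complex" where
  "J_mset q A = J_fun q (SOME xs. mset xs = A)"

definition nonzero_eigs :: "complex mat \<Rightarrow> complex multiset" where
  "nonzero_eigs A = filter_mset (\<lambda>x. x \<noteq> 0) (proots (char_poly A))"

definition principal :: "'a mat \<Rightarrow> nat set \<Rightarrow> 'a mat" where
  "principal A Q = submatrix A Q Q"

end

theory Submission
  imports Defs
begin

text \<open>By Sylvester's identity and expansion into principal minors, \<open>det (I + \<rho> G G\<^sup>\<dagger>)\<close> is the sum of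
  \<open>\<rho>\<^bsup>|Q|\<^esup> det ((G\<^sup>\<dagger> G)\<^sub>Q)\<close> over all \<open>Q\<close>. Since \<open>G\<^sup>\<dagger> G\<close> is a sum of rank-one matrices, one for each row of \<open>G\<close>,
  such a minor is a sum over injective assignments of rows to columns. The rows are independent with second
  moments \<open>\<Psi> + g\<^sub>r\<^sup>\<dagger> g\<^sub>r\<close>, where \<open>g\<^sub>r\<close> is row \<open>r\<close> of the mean, so the expectation of each term replaces column \<open>j\<close> by the
  corresponding column of \<open>\<Psi> + g\<^sub>r\<^sup>\<dagger> g\<^sub>r\<close> (nothing about the Gaussian law beyond its first two moments enters).
  Expanding once more, the set \<open>K\<close> of columns taken from the rank-one parts contributes
  \<open>(n - |K|)! / (n - |Q|)!\<close> times the determinant with columns of \<open>\<Sigma>\<close> on \<open>K\<close> and of \<open>\<Psi>\<close> elsewhere. These mixed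
  determinants are the coefficients of the pencil \<open>det (X \<Psi>\<^sub>Q - \<Sigma>\<^sub>Q)\<close>, that is, up to sign and the factor
  \<open>det \<Psi>\<^sub>Q\<close>, the elementary symmetric functions of the eigenvalues of \<open>\<Psi>\<^sub>Q\<^sup>-\<^sup>1 \<Sigma>\<^sub>Q\<close>, and \<open>J\<close> is the matching linear combination
  of them. Jensen's inequality for the logarithm finishes the proof.\<close>

subsection \<open>Determinants indexed by finite sets\<close>

text \<open>Indexing by an arbitrary finite set gives principal minors without renumbering rows and columns.\<close>

definition pdet :: "'i set \<Rightarrow> ('i \<Rightarrow> 'i \<Rightarrow> 'a) \<Rightarrow> 'a :: comm_ring_1" where
  "pdet Q A = (\<Sum>p | p permutes Q. of_int (sign p) * (\<Prod>j\<in>Q. A (p j) j))"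

text \<open>Models the assignments of pairwise distinct rows in \<open>N\<close> to the columns in
  \<open>Q\<close>. Extensionality makes the set finite for finite \<open>Q\<close> and
  \<open>N\<close>, and lets such a map be rebuilt from its values on the parts of
  \<open>Q\<close>.\<close>

definition injE :: "'i set \<Rightarrow> 'b set \<Rightarrow> ('i \<Rightarrow> 'b) set" where
  "injE Q N = {f \<in> Q \<rightarrow>\<^sub>E N. inj_on f Q}"

lemma pdet_cong:
  assumes "\<And>i j. i \<in> Q \<Longrightarrow> j \<in> Q \<Longrightarrow> A i j = B i j"
  shows "pdet Q A = pdet Q B"
  unfolding pdet_def
  by (intro sum.cong refl arg_cong2[of _ _ _ _ "(*)"] prod.cong assms) (auto simp: permutes_in_image)

lemma det_eq_pdet:
  assumes "A \<in> carrier_mat n n"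
  shows "Determinant.det A = pdet {..<n} (\<lambda>i j. A $$ (i, j))"
  unfolding det_col[OF assms] pdet_def by (simp add: atLeast0LessThan)

text \<open>Conjugation by \<open>\<phi>\<close> matches the permutations of \<open>P\<close> with
  those of \<open>Q\<close> and preserves the sign.\<close>

lemma pdet_reindex:
  fixes A :: "'i \<Rightarrow> 'i \<Rightarrow> 'a :: comm_ring_1"
  assumes "bij_betw \<phi> P Q" "finite P"
  shows "pdet Q A = pdet P (\<lambda>i j. A (\<phi> i) (\<phi> j))"
proof -
  have inj: "inj_on \<phi> P" and Q: "Q = \<phi> ` P"
    using assms by (auto simp: bij_betw_def)
  have "pdet Q A = (\<Sum>p | p permutes P. of_int (sign (map_permutation P \<phi> p))
      * (\<Prod>j\<in>Q. A (map_permutation P \<phi> p j) j))"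
    unfolding pdet_def
    using sum.reindex_bij_betw[OF bij_betw_permutations[OF assms(1)],
        of "\<lambda>p. of_int (sign p) * (\<Prod>j\<in>Q. A (p j) j)"]
    by (simp add: map_permutation_def restrict_id_def Q o_def)
  also have "\<dots> = pdet P (\<lambda>i j. A (\<phi> i) (\<phi> j))"
    unfolding pdet_def
  proof (intro sum.cong refl arg_cong2[of _ _ _ _ "(*)"])
    fix p assume "p \<in> {p. p permutes P}"
    hence p: "p permutes P" by simp
    show "(of_int (sign (map_permutation P \<phi> p)) :: 'a) = of_int (sign p)"
      using sign_map_permutation[OF inj p assms(2)] by simp
    show "(\<Prod>j\<in>Q. A (map_permutation P \<phi> p j) j) = (\<Prod>j\<in>P. A (\<phi> (p j)) (\<phi> j))"
      unfolding Q using inj p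
      by (subst prod.reindex) (auto intro!: prod.cong simp: map_permutation_apply)
  qed
  finally show ?thesis .
qed

text \<open>\<open>submatrix\<close> numbers rows and columns through \<open>pick Q\<close>, the
  increasing enumeration of \<open>Q\<close>. Being strictly increasing it is injective, and
  counting makes it onto. This links principal submatrices to \<open>pdet Q\<close>.\<close>

lemma bij_betw_pick:
  assumes "finite Q"
  shows "bij_betw (pick Q) {..<card Q} Q"
proof -
  have "inj_on (pick Q) {..<card Q}"
  proof (rule linorder_inj_onI')
    fix i j assume "i \<in> {..<card Q}" "j \<in> {..<card Q}" "i < j"
    thus "pick Q i \<noteq> pick Q j" using pick_mono_le[of j Q i] by simp
  qed
  moreover have "pick Q ` {..<card Q} \<subseteq> Q"
    using pick_in_set_le by auto
  ultimately show ?thesis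
    using assms by (auto simp: bij_betw_def card_image card_subset_eq)
qed

lemma principal_carrier:
  assumes "A \<in> carrier_mat n n" "Q \<subseteq> {..<n}"
  shows "principal A Q \<in> carrier_mat (card Q) (card Q)"
proof -
  have "{i. i < n \<and> i \<in> Q} = Q" using assms(2) by auto
  thus ?thesis using assms(1) by (auto simp: principal_def submatrix_def)
qed

lemma principal_index:
  assumes "A \<in> carrier_mat n n" "Q \<subseteq> {..<n}" "i < card Q" "j < card Q"
  shows "principal A Q $$ (i, j) = A $$ (pick Q i, pick Q j)"
proof -
  have "{i. i < n \<and> i \<in> Q} = Q" using assms(2) by auto
  thus ?thesis using assms by (auto simp: principal_def submatrix_index)
qed

lemma pdet_pick:
  assumes "Q \<subseteq> {..<n}"
  shows "pdet {..<card Q} (\<lambda>i j. A (pick Q i) (pick Q j)) = pdet Q A"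
  using pdet_reindex[OF bij_betw_pick, of Q A] assms by (simp add: finite_subset[OF assms])

lemma det_principal:
  assumes "A \<in> carrier_mat n n" "Q \<subseteq> {..<n}"
  shows "Determinant.det (principal A Q) = pdet Q (\<lambda>i j. A $$ (i, j))"
  unfolding det_eq_pdet[OF principal_carrier[OF assms]]
  by (subst pdet_pick[OF assms(2), symmetric])
     (intro pdet_cong, simp add: principal_index[OF assms])

text \<open>Multilinearity in the columns: \<open>K\<close> records the columns drawn from the
  second summand when the product of each permutation is multiplied out.\<close>

lemma pdet_add:
  assumes "finite Q"
  shows "pdet Q (\<lambda>i j. A i j + B i j) = (\<Sum>K\<in>Pow Q. pdet Q (\<lambda>i j. if j \<in> K then B i j else A i j))"
proof -
  have *: "(\<Prod>j\<in>Q. A (p j) j + B (p j) j) =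
      (\<Sum>K\<in>Pow Q. \<Prod>j\<in>Q. if j \<in> K then B (p j) j else A (p j) j)" for p
  proof -
    have "(\<Prod>j\<in>Q. B (p j) j + A (p j) j) = (\<Sum>K\<in>Pow Q. (\<Prod>j\<in>K. B (p j) j) * (\<Prod>j\<in>Q-K. A (p j) j))"
      by (rule prod_add[OF assms])
    also have "\<dots> = (\<Sum>K\<in>Pow Q. \<Prod>j\<in>Q. if j \<in> K then B (p j) j else A (p j) j)"
    proof (intro sum.cong refl)
      fix K assume "K \<in> Pow Q"
      hence "Q \<inter> {x. x \<in> K} = K" "Q \<inter> - {x. x \<in> K} = Q - K" by auto
      thus "(\<Prod>j\<in>K. B (p j) j) * (\<Prod>j\<in>Q-K. A (p j) j) = (\<Prod>j\<in>Q. if j \<in> K then B (p j) j else A (p j) j)"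
        by (simp add: prod.If_cases[OF assms])
    qed
    finally show ?thesis by (simp add: add.commute)
  qed
  show ?thesis
    unfolding pdet_def * sum_distrib_left by (rule sum.swap)
qed

text \<open>Multilinearity once more: \<open>h\<close> chooses one summand for every column in
  \<open>K\<close>.\<close>

lemma pdet_sum_columns:
  assumes "finite Q" "K \<subseteq> Q" "finite N"
  shows "pdet Q (\<lambda>i j. if j \<in> K then (\<Sum>r\<in>N. c r i j) else A i j) =
    (\<Sum>h\<in>K \<rightarrow>\<^sub>E N. pdet Q (\<lambda>i j. if j \<in> K then c (h j) i j else A i j))"
proof -
  have K: "finite K" "Q \<inter> {x. x \<in> K} = K" "Q \<inter> - {x. x \<in> K} = Q - K"
    using assms finite_subset by auto
  have *: "(\<Prod>j\<in>Q. if j \<in> K then (\<Sum>r\<in>N. c r (p j) j) else A (p j) j) =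
      (\<Sum>h\<in>K \<rightarrow>\<^sub>E N. \<Prod>j\<in>Q. if j \<in> K then c (h j) (p j) j else A (p j) j)" for p
    unfolding prod.If_cases[OF assms(1)] K sum_distrib_right[symmetric]
    by (subst prod_sum_PiE) (use K assms in auto)
  show ?thesis
    unfolding pdet_def * sum_distrib_left by (rule sum.swap)
qed

lemma pdet_smult_columns:
  assumes "finite Q"
  shows "pdet Q (\<lambda>i j. A i j * v j) = pdet Q A * (\<Prod>j\<in>Q. v j)"
  unfolding pdet_def by (simp add: prod.distrib sum_distrib_right mult.assoc)

text \<open>Columns \<open>j\<close> and \<open>k\<close> are multiples of the same vector
  \<open>u\<close>. Exchanging the images of \<open>j\<close> and \<open>k\<close> under a
  permutation flips its sign but keeps its product, since the two factors combine to
  \<open>u (p j) * u (p k) * v j * v k\<close>. The determinant thus equals its own negative, and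
  characteristic zero makes it vanish.\<close>

lemma pdet_two_columns:
  fixes A :: "'i \<Rightarrow> 'i \<Rightarrow> 'a :: {idom, ring_char_0}"
  assumes fin: "finite Q" and jk: "j \<in> Q" "k \<in> Q" "j \<noteq> k"
    and Aj: "\<And>i. A i j = u i * v j" and Ak: "\<And>i. A i k = u i * v k"
  shows "pdet Q A = 0"
proof -
  let ?t = "Transposition.transpose j k"
  have t: "?t permutes Q" using jk by (simp add: permutes_swap_id)
  have "pdet Q A = (\<Sum>p | p permutes Q. of_int (sign (p \<circ> ?t)) * (\<Prod>i\<in>Q. A ((p \<circ> ?t) i) i))"
    unfolding pdet_def by (rule sum_permutations_compose_right[OF t])
  also have "\<dots> = (\<Sum>p | p permutes Q. - (of_int (sign p) * (\<Prod>i\<in>Q. A (p i) i)))"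
  proof (intro sum.cong refl)
    fix p assume "p \<in> {p. p permutes Q}"
    hence p: "p permutes Q" by simp
    have "sign (p \<circ> ?t) = - sign p"
      using jk(3) permutes_imp_permutation[OF fin p] permutes_imp_permutation[OF fin t]
      by (simp add: sign_compose sign_swap_id)
    moreover have "(\<Prod>i\<in>Q. A ((p \<circ> ?t) i) i) = (\<Prod>i\<in>Q. A (p i) i)"
    proof -
      have Q: "prod g Q = g j * (g k * prod g (Q - {j,k}))" for g :: "'i \<Rightarrow> 'a"
      proof -
        have "Q - {j} - {k} = Q - {j,k}" by auto
        thus ?thesis
          using fin jk prod.remove[of Q j g] prod.remove[of "Q - {j}" k g] by auto
      qed
      have "(\<Prod>i\<in>Q - {j,k}. A ((p \<circ> ?t) i) i) = (\<Prod>i\<in>Q - {j,k}. A (p i) i)"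
        by (intro prod.cong) (auto simp: Transposition.transpose_def)
      thus ?thesis
        unfolding Q by (simp add: Aj Ak mult_ac)
    qed
    ultimately show "of_int (sign (p \<circ> ?t)) * (\<Prod>i\<in>Q. A ((p \<circ> ?t) i) i) =
       - (of_int (sign p) * (\<Prod>i\<in>Q. A (p i) i))" by simp
  qed
  also have "\<dots> = - pdet Q A" by (simp add: pdet_def sum_negf)
  finally have "pdet Q A = - pdet Q A" .
  hence "pdet Q A + pdet Q A = 0" by (simp only: eq_neg_iff_add_eq_0)
  thus ?thesis by (simp flip: mult_2)
qed

text \<open>A permutation moving a column outside \<open>K\<close> meets an off-diagonal zero there,
  so only permutations of \<open>K\<close> contribute.\<close>

lemma pdet_identity_columns:
  fixes B :: "'i \<Rightarrow> 'i \<Rightarrow> 'a :: comm_ring_1"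
  assumes fin: "finite Q" and K: "K \<subseteq> Q"
  shows "pdet Q (\<lambda>i j. if j \<in> K then B i j else if i = j then d else 0) = d ^ card (Q - K) * pdet K B"
proof -
  have sub: "{p. p permutes K} \<subseteq> {p. p permutes Q}" using K permutes_subset by blast
  let ?A = "\<lambda>i j. if j \<in> K then B i j else if i = j then d else 0"
  have "pdet Q ?A = (\<Sum>p | p permutes K. of_int (sign p) * (\<Prod>j\<in>Q. ?A (p j) j))"
    unfolding pdet_def
  proof (rule sum.mono_neutral_right)
    show "\<forall>p\<in>{p. p permutes Q} - {p. p permutes K}. of_int (sign p) * (\<Prod>j\<in>Q. ?A (p j) j) = 0"
    proof
      fix p assume "p \<in> {p. p permutes Q} - {p. p permutes K}"
      hence p: "p permutes Q" "\<not> p permutes K" by auto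
      have "\<exists>j\<in>Q - K. p j \<noteq> j"
      proof (rule ccontr)
        assume "\<not> ?thesis"
        hence "p permutes K" using permutes_superset[OF p(1), of K] by auto
        thus False using p(2) by simp
      qed
      then obtain j where "j \<in> Q" "j \<notin> K" "p j \<noteq> j" by auto
      hence "(\<Prod>j\<in>Q. ?A (p j) j) = 0" using fin by (intro prod_zero) auto
      thus "of_int (sign p) * (\<Prod>j\<in>Q. ?A (p j) j) = 0" by simp
    qed
  qed (use fin sub finite_permutations in auto)
  also have "\<dots> = (\<Sum>p | p permutes K. d ^ card (Q - K) * (of_int (sign p) * (\<Prod>j\<in>K. B (p j) j)))"
  proof (intro sum.cong refl)
    fix p assume "p \<in> {p. p permutes K}"
    hence p: "p permutes K" by simp
    have KQ: "Q \<inter> {x. x \<in> K} = K" "Q \<inter> - {x. x \<in> K} = Q - K" using K by auto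
    have "(\<Prod>j\<in>Q. ?A (p j) j) = (\<Prod>j\<in>K. B (p j) j) * (\<Prod>j\<in>Q-K. if p j = j then d else 0)"
      by (simp only: prod.If_cases[OF fin] KQ)
    also have "(\<Prod>j\<in>Q-K. if p j = j then d else 0) = (\<Prod>j\<in>Q-K. d)"
      using permutes_not_in[OF p] by (intro prod.cong) auto
    finally show "of_int (sign p) * (\<Prod>j\<in>Q. ?A (p j) j) =
        d ^ card (Q - K) * (of_int (sign p) * (\<Prod>j\<in>K. B (p j) j))" by (simp add: mult_ac)
  qed
  also have "\<dots> = d ^ card (Q - K) * pdet K B"
    by (simp add: pdet_def sum_distrib_left)
  finally show ?thesis .
qed

text \<open>The expansion into principal minors. The case \<open>d = 1\<close> serves the channel
  determinant, general \<open>d\<close> the minors of \<open>Psi\<close>.\<close>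

lemma pdet_scalar_add:
  assumes fin: "finite Q"
  shows "pdet Q (\<lambda>i j. (if i = j then d else 0) + c * B i j) =
    (\<Sum>K\<in>Pow Q. d ^ card (Q - K) * c ^ card K * pdet K B)"
proof -
  have "pdet Q (\<lambda>i j. (if i = j then d else 0) + c * B i j) =
     (\<Sum>K\<in>Pow Q. pdet Q (\<lambda>i j. if j \<in> K then B i j * c else if i = j then d else 0))"
    by (subst pdet_add[OF fin]) (simp add: mult.commute cong: if_cong)
  also have "\<dots> = (\<Sum>K\<in>Pow Q. d ^ card (Q - K) * c ^ card K * pdet K B)"
  proof (intro sum.cong refl)
    fix K assume K: "K \<in> Pow Q"
    hence "finite K" using fin finite_subset by auto
    thus "pdet Q (\<lambda>i j. if j \<in> K then B i j * c else if i = j then d else 0) =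
      d ^ card (Q - K) * c ^ card K * pdet K B"
      using K by (subst pdet_identity_columns[OF fin]) (auto simp: pdet_smult_columns)
  qed
  finally show ?thesis .
qed

section \<open>Sums over injective maps\<close>

lemma finite_injE: "finite Q \<Longrightarrow> finite N \<Longrightarrow> finite (injE Q N)"
  unfolding injE_def by (intro finite_subset[OF _ finite_PiE[of Q "\<lambda>_. N"]]) auto

text \<open>Pigeonhole principle; it is the reason why the bound stops at minors of size
  \<open>Nr\<close>.\<close>

lemma injE_empty_if_card_less:
  assumes "finite N" "card N < card Q"
  shows "injE Q N = {}"
proof -
  have False if "f \<in> Q \<rightarrow>\<^sub>E N" "inj_on f Q" for f
    using card_inj_on_le[OF that(2), of N] that(1) assms by auto
  thus ?thesis by (auto simp: injE_def)
qed

text \<open>An injective map on \<open>insert x S\<close> amounts to an injective map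
  \<open>g\<close> on \<open>S\<close> and a value for \<open>x\<close> that \<open>g\<close> has
  not taken.\<close>

lemma sum_injE_insert:
  assumes "finite S" "finite N" "x \<notin> S"
  shows "(\<Sum>f\<in>injE (insert x S) N. F f) = (\<Sum>g\<in>injE S N. \<Sum>y\<in>N - g ` S. F (g(x := y)))"
proof -
  have "(\<Sum>g\<in>injE S N. \<Sum>y\<in>N - g ` S. F (g(x := y))) =
      (\<Sum>(g, y)\<in>(SIGMA g:injE S N. N - g ` S). F (g(x := y)))"
    using assms by (subst sum.Sigma) (auto simp: finite_injE)
  also have "\<dots> = (\<Sum>f\<in>injE (insert x S) N. F f)"
  proof (rule sum.reindex_bij_witness[where i = "\<lambda>f. (restrict f S, f x)" and j = "\<lambda>(g, y). g(x := y)"])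
    fix a assume a: "a \<in> (SIGMA g:injE S N. N - g ` S)"
    obtain g y where [simp]: "a = (g, y)" by (cases a)
    have g: "g \<in> S \<rightarrow>\<^sub>E N" "inj_on g S" "y \<in> N" "y \<notin> g ` S" using a by (auto simp: injE_def)
    have "restrict (g(x := y)) S = g"
      using g(1) assms(3) by (auto simp: fun_eq_iff restrict_def PiE_def extensional_def)
    thus "(restrict ((case a of (g, y) \<Rightarrow> g(x := y))) S, (case a of (g, y) \<Rightarrow> g(x := y)) x) = a"
      by simp
    show "(case a of (g, y) \<Rightarrow> g(x := y)) \<in> injE (insert x S) N"
      using g assms(3) by (auto simp: injE_def inj_on_def PiE_def extensional_def Pi_def)
  next
    fix f assume f: "f \<in> injE (insert x S) N"
    have "(restrict f S)(x := f x) = f"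
      using f by (auto simp: injE_def fun_eq_iff restrict_def PiE_def extensional_def)
    thus "(case (restrict f S, f x) of (g, y) \<Rightarrow> g(x := y)) = f" by simp
    show "(restrict f S, f x) \<in> (SIGMA g:injE S N. N - g ` S)"
      using f assms(3) by (auto simp: injE_def inj_on_def)
  qed auto
  finally show ?thesis ..
qed

text \<open>The summand sees only the values on \<open>K\<close>, and the injective extensions of a
  map from \<open>K\<close> to \<open>K \<union> D\<close> are counted by a falling factorial,
  adding one point of \<open>D\<close> at a time.\<close>

lemma sum_injE_restrict:
  fixes F :: "('i \<Rightarrow> 'b) \<Rightarrow> 'a :: comm_ring_1"
  assumes "finite K" "finite D" "finite N" "K \<inter> D = {}"
  shows "(\<Sum>f\<in>injE (K \<union> D) N. F (restrict f K)) =
    (\<Prod>i\<in>{card K..<card K + card D}. of_nat (card N - i)) * (\<Sum>h\<in>injE K N. F h)"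
  using assms(2,4)
proof (induction D rule: finite_induct)
  case empty
  have "restrict f K = f" if "f \<in> injE K N" for f
    using that by (auto simp: injE_def PiE_def extensional_restrict)
  thus ?case by simp
next
  case (insert x D)
  have x: "x \<notin> K \<union> D" using insert by auto
  have "(\<Sum>f\<in>injE (K \<union> insert x D) N. F (restrict f K)) =
    (\<Sum>g\<in>injE (K \<union> D) N. \<Sum>y\<in>N - g ` (K \<union> D). F (restrict (g(x := y)) K))"
    using insert assms by (simp only: Un_insert_right sum_injE_insert[OF _ assms(3) x] finite_UnI)
  also have "\<dots> = (\<Sum>g\<in>injE (K \<union> D) N. of_nat (card N - (card K + card D)) * F (restrict g K))"
  proof (intro sum.cong refl)
    fix g assume g: "g \<in> injE (K \<union> D) N"
    \<comment> \<open>These are the values already taken. The value given to \<open>x\<close> does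
      not affect the restriction to \<open>K\<close>, so the inner sum is constant.\<close>
    have "card (g ` (K \<union> D)) = card K + card D"
      using g insert assms by (subst card_image) (auto simp: injE_def card_Un_disjoint)
    moreover have "g ` (K \<union> D) \<subseteq> N" using g by (auto simp: injE_def)
    ultimately have "card (N - g ` (K \<union> D)) = card N - (card K + card D)"
      using assms insert by (subst card_Diff_subset) auto
    moreover have "restrict (g(x := y)) K = restrict g K" for y
      using x by (auto simp: restrict_def fun_eq_iff)
    ultimately show "(\<Sum>y\<in>N - g ` (K \<union> D). F (restrict (g(x := y)) K)) =
        of_nat (card N - (card K + card D)) * F (restrict g K)" by simp
  qed
  also have "\<dots> = of_nat (card N - (card K + card D)) * (\<Sum>g\<in>injE (K \<union> D) N. F (restrict g K))"
    by (simp add: sum_distrib_left)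
  also have "\<dots> = (\<Prod>i\<in>{card K..<card K + card (insert x D)}. of_nat (card N - i)) * (\<Sum>h\<in>injE K N. F h)"
  proof -
    have "K \<inter> D = {}" using insert by auto
    show ?thesis using insert.hyps by (subst insert.IH[OF \<open>K \<inter> D = {}\<close>]) (simp add: mult_ac)
  qed
  finally show ?case .
qed

lemma prod_diff_eq_fact_div:
  assumes "k \<le> t" "t \<le> n"
  shows "(\<Prod>i\<in>{k..<t}. of_nat (n - i)) = (fact (n - k) / fact (n - t) :: 'a :: field_char_0)"
  using assms
proof (induction t rule: dec_induct)
  case (step t)
  have "fact (n - t) = (of_nat (n - t) * fact (n - Suc t) :: 'a)"
    using step by (metis Suc_diff_Suc Suc_le_lessD fact_Suc)
  moreover have "n - t \<noteq> 0" using step by simp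
  moreover have "(\<Prod>i\<in>{k..<Suc t}. of_nat (n - i)) = (fact (n - k) / fact (n - t) * of_nat (n - t) :: 'a)"
    using step by simp
  ultimately show ?case by simp
qed simp

text \<open>The terms with a repeated row vanish because two of their columns are proportional.\<close>

lemma pdet_rank_one_sum:
  fixes A :: "'i \<Rightarrow> 'i \<Rightarrow> 'a :: {idom, ring_char_0}"
  assumes "finite Q" "K \<subseteq> Q" "finite N"
  shows "pdet Q (\<lambda>i j. if j \<in> K then (\<Sum>r\<in>N. u r i * v r j) else A i j) =
    (\<Sum>h\<in>injE K N. pdet Q (\<lambda>i j. if j \<in> K then u (h j) i * v (h j) j else A i j))"
proof -
  have K: "finite K" using assms finite_subset by auto
  have "pdet Q (\<lambda>i j. if j \<in> K then (\<Sum>r\<in>N. u r i * v r j) else A i j) =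
     (\<Sum>h\<in>K \<rightarrow>\<^sub>E N. pdet Q (\<lambda>i j. if j \<in> K then u (h j) i * v (h j) j else A i j))"
    by (rule pdet_sum_columns[OF assms])
  also have "\<dots> = (\<Sum>h\<in>injE K N. pdet Q (\<lambda>i j. if j \<in> K then u (h j) i * v (h j) j else A i j))"
  proof (rule sum.mono_neutral_right)
    show "\<forall>h\<in>(K \<rightarrow>\<^sub>E N) - injE K N. pdet Q (\<lambda>i j. if j \<in> K then u (h j) i * v (h j) j else A i j) = 0"
    proof
      fix h assume h: "h \<in> (K \<rightarrow>\<^sub>E N) - injE K N"
      then obtain j k where jk: "j \<in> K" "k \<in> K" "j \<noteq> k" "h j = h k"
        by (auto simp: injE_def inj_on_def)
      thus "pdet Q (\<lambda>i j. if j \<in> K then u (h j) i * v (h j) j else A i j) = 0"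
        using assms by (intro pdet_two_columns[of Q j k _ "u (h j)" "\<lambda>j. v (h j) j"]) auto
    qed
  qed (use K assms finite_PiE in \<open>auto simp: injE_def\<close>)
  finally show ?thesis .
qed

text \<open>A Cauchy-Binet formula that sums over assignments of distinct rows to columns instead of
  over row sets; it is \<open>pdet_rank_one_sum\<close> with \<open>K = Q\<close>.\<close>

lemma pdet_gram:
  fixes u v :: "'b \<Rightarrow> 'i \<Rightarrow> 'a :: {idom, ring_char_0}"
  assumes "finite Q" "finite N"
  shows "pdet Q (\<lambda>i j. \<Sum>r\<in>N. u r i * v r j) = (\<Sum>f\<in>injE Q N. pdet Q (\<lambda>i j. u (f j) i * v (f j) j))"
proof -
  have "pdet Q (\<lambda>i j. \<Sum>r\<in>N. u r i * v r j) =
    pdet Q (\<lambda>i j. if j \<in> Q then (\<Sum>r\<in>N. u r i * v r j) else 0)" by (rule pdet_cong) simp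
  also have "\<dots> = (\<Sum>f\<in>injE Q N. pdet Q (\<lambda>i j. if j \<in> Q then u (f j) i * v (f j) j else 0))"
    by (rule pdet_rank_one_sum) (use assms in auto)
  also have "\<dots> = (\<Sum>f\<in>injE Q N. pdet Q (\<lambda>i j. u (f j) i * v (f j) j))"
    by (intro sum.cong refl pdet_cong) simp
  finally show ?thesis .
qed

text \<open>Expand by the set \<open>K\<close> of columns taken from the rank-one parts. Only the
  restriction of \<open>f\<close> to \<open>K\<close> then matters, its extensions give the quotient
  of factorials, and the remaining injective maps on \<open>K\<close> reassemble the full sum over
  rows.\<close>

lemma sum_injE_pdet_rank_one_update:
  fixes A :: "'i \<Rightarrow> 'i \<Rightarrow> 'a :: {field_char_0}"
  assumes fin: "finite Q" "finite N" and le: "card Q \<le> card N"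
  shows "(\<Sum>f\<in>injE Q N. pdet Q (\<lambda>i j. A i j + u (f j) i * v (f j) j)) =
    (\<Sum>K\<in>Pow Q. fact (card N - card K) / fact (card N - card Q) *
       pdet Q (\<lambda>i j. if j \<in> K then (\<Sum>r\<in>N. u r i * v r j) else A i j))"
proof -
  let ?F = "\<lambda>K f. pdet Q (\<lambda>i j. if j \<in> K then u (f j) i * v (f j) j else A i j)"
  have "(\<Sum>f\<in>injE Q N. pdet Q (\<lambda>i j. A i j + u (f j) i * v (f j) j)) =
    (\<Sum>f\<in>injE Q N. \<Sum>K\<in>Pow Q. ?F K f)"
    by (simp add: pdet_add[OF fin(1)])
  also have "\<dots> = (\<Sum>K\<in>Pow Q. \<Sum>f\<in>injE Q N. ?F K f)" by (rule sum.swap)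
  also have "\<dots> = (\<Sum>K\<in>Pow Q. fact (card N - card K) / fact (card N - card Q) *
       pdet Q (\<lambda>i j. if j \<in> K then (\<Sum>r\<in>N. u r i * v r j) else A i j))"
  proof (intro sum.cong refl)
    fix K assume "K \<in> Pow Q"
    hence K: "K \<subseteq> Q" "finite K" using fin finite_subset by auto
    have Q: "K \<union> (Q - K) = Q" using K by auto
    have c: "card K + card (Q - K) = card Q"
      using K fin by (metis card_Diff_subset card_mono le_add_diff_inverse)
    have "(\<Sum>f\<in>injE Q N. ?F K f) = (\<Sum>f\<in>injE Q N. ?F K (restrict f K))"
      by (intro sum.cong refl pdet_cong) auto
    also have "\<dots> = (\<Prod>i\<in>{card K..<card Q}. of_nat (card N - i)) * (\<Sum>h\<in>injE K N. ?F K h)"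
      using sum_injE_restrict[of K "Q - K" N "?F K"] K fin Q c by simp
    \<comment> \<open>Here the expansion is read backwards: maps that repeat a row may be added,
      because their terms vanish.\<close>
    also have "(\<Sum>h\<in>injE K N. ?F K h) = pdet Q (\<lambda>i j. if j \<in> K then (\<Sum>r\<in>N. u r i * v r j) else A i j)"
      by (rule pdet_rank_one_sum[symmetric]) (use K fin in auto)
    also have "(\<Prod>i\<in>{card K..<card Q}. of_nat (card N - i)) = (fact (card N - card K) / fact (card N - card Q) :: 'a)"
      by (rule prod_diff_eq_fact_div) (use card_mono[OF fin(1) K(1)] le in auto)
    finally show "(\<Sum>f\<in>injE Q N. ?F K f) = fact (card N - card K) / fact (card N - card Q) *
       pdet Q (\<lambda>i j. if j \<in> K then (\<Sum>r\<in>N. u r i * v r j) else A i j)" .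
  qed
  finally show ?thesis .
qed

subsection \<open>The symmetric function J\<close>

text \<open>A Vandermonde matrix bordered by an arbitrary last row. Powers of a further point as
  border give the next Vandermonde matrix; the values of a linear functional give access to
  \<open>J_ratio\<close>.\<close>

definition vandermonde_row :: "nat \<Rightarrow> (nat \<Rightarrow> 'a) \<Rightarrow> (nat \<Rightarrow> 'a) \<Rightarrow> 'a :: comm_ring_1 mat" where
  "vandermonde_row L x F = mat (Suc L) (Suc L) (\<lambda>(i, j). if i < L then x i ^ j else F j)"

definition vandermonde_det :: "nat \<Rightarrow> (nat \<Rightarrow> 'a) \<Rightarrow> 'a :: comm_ring_1" where
  "vandermonde_det L x = Determinant.det (mat L L (\<lambda>(i, j). x i ^ j))"

text \<open>The determinant is linear in the border \<open>F\<close>. For a border of powers of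
  \<open>y\<close> it is a polynomial in \<open>y\<close> with roots \<open>x i\<close>, so the
  cofactors of the border are the coefficients of the monic polynomial with these roots, up to the
  Vandermonde factor.\<close>

lemma det_vandermonde_row:
  fixes x F :: "nat \<Rightarrow> 'a :: field"
  assumes inj: "inj_on x {..<L}"
  shows "Determinant.det (vandermonde_row L x F) =
    vandermonde_det L x * (\<Sum>j\<le>L. F j * coeff (\<Prod>i<L. [:- x i, 1:]) j)"
proof -
  let ?W = "vandermonde_row L x"
  let ?P = "\<Prod>i<L. [:- x i, 1:]"
  \<comment> \<open>The last row does not enter its own cofactors, so they can be read off with a
    zero border.\<close>
  define C where "C j = cofactor (?W (\<lambda>_. 0)) L j" for j
  have W: "?W F \<in> carrier_mat (Suc L) (Suc L)" for F by (simp add: vandermonde_row_def)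
  have del: "mat_delete (?W F) L j = mat_delete (?W (\<lambda>_. 0)) L j" for F j
    by (rule eq_matI) (auto simp: mat_delete_def vandermonde_row_def)
  have expand: "Determinant.det (?W F) = (\<Sum>j\<le>L. F j * C j)" for F
    unfolding laplace_expansion_row[OF W lessI] lessThan_Suc_atMost C_def cofactor_def del[of F]
    by (intro sum.cong refl) (simp add: vandermonde_row_def)
  define D where "D = (\<Sum>j\<le>L. monom (C j) j)"
  have D: "coeff D j = (if j \<le> L then C j else 0)" for j
    by (simp add: D_def coeff_sum)
  have polyD: "poly D y = Determinant.det (?W (\<lambda>j. y ^ j))" for y
    by (simp add: D_def poly_sum poly_monom expand mult.commute)
  have CL: "C L = vandermonde_det L x"
    unfolding C_def cofactor_def vandermonde_det_def
    by (simp flip: mult_2 power_add,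
        intro arg_cong[of _ _ Determinant.det] eq_matI) (auto simp: mat_delete_def vandermonde_row_def)
  have degP: "degree ?P = L"
    by (subst degree_prod_sum_eq) auto
  have monP: "coeff ?P L = 1"
    using lead_coeff_prod[of "\<lambda>i. [:- x i, 1:]" "{..<L}"] by (simp add: degP)
  \<comment> \<open>Both sides have degree at most \<open>L\<close> and the same coefficient at
    \<open>L\<close>, so agreement at the \<open>L\<close> distinct points suffices. There the
    bordered matrix has two equal rows.\<close>
  have "D = Polynomial.smult (vandermonde_det L x) ?P"
  proof (rule poly_eqI_degree_lead_coeff[where n = L and A = "x ` {..<L}"])
    show "L \<le> card (x ` {..<L})" by (simp add: card_image[OF inj])
    show "degree D \<le> L" by (rule degree_le) (simp add: D)
    show "degree (Polynomial.smult (vandermonde_det L x) ?P) \<le> L"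
      using degree_smult_le[of "vandermonde_det L x" ?P] degP by simp
    show "coeff D L = coeff (Polynomial.smult (vandermonde_det L x) ?P) L" by (simp add: D CL monP)
    fix z assume "z \<in> x ` {..<L}"
    then obtain i where i: "i < L" "z = x i" by auto
    have "Determinant.det (?W (\<lambda>j. z ^ j)) = 0"
      by (rule det_identical_rows[OF W, of i L]) (use i in \<open>auto simp: vandermonde_row_def\<close>)
    moreover have "poly ?P z = 0" using i by (auto simp: poly_prod prod_zero_iff)
    ultimately show "poly D z = poly (Polynomial.smult (vandermonde_det L x) ?P) z" by (simp add: polyD)
  qed
  hence "C j = vandermonde_det L x * coeff ?P j" if "j \<le> L" for j
    using D[of j] that by simp
  thus ?thesis by (simp add: expand sum_distrib_left mult_ac)
qed

text \<open>Bordering by the powers of \<open>x L\<close> leads from size \<open>L\<close> to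
  \<open>Suc L\<close>; evaluating the polynomial with roots \<open>x i\<close> at
  \<open>x L\<close> supplies the factors of the new pairs \<open>(i, L)\<close>.\<close>

lemma vandermonde_det_eq:
  fixes x :: "nat \<Rightarrow> 'a :: field"
  assumes "inj_on x {..<L}"
  shows "vandermonde_det L x = (\<Prod>(i, j) \<in> {(i, j). i < j \<and> j < L}. x j - x i)"
  using assms
proof (induction L)
  case 0
  show ?case by (simp add: vandermonde_det_def)
next
  case (Suc L)
  have inj: "inj_on x {..<L}" using Suc.prems by (rule inj_on_subset) auto
  have degP: "degree (\<Prod>i<L. [:- x i, 1:]) = L"
    by (subst degree_prod_sum_eq) auto
  have "mat (Suc L) (Suc L) (\<lambda>(i, j). x i ^ j) = vandermonde_row L x (\<lambda>j. x L ^ j)"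
    by (rule eq_matI) (auto simp: vandermonde_row_def less_Suc_eq)
  hence "vandermonde_det (Suc L) x = vandermonde_det L x * (\<Sum>j\<le>L. x L ^ j * coeff (\<Prod>i<L. [:- x i, 1:]) j)"
    unfolding vandermonde_det_def[of "Suc L"] by (simp add: det_vandermonde_row[OF inj])
  also have "(\<Sum>j\<le>L. x L ^ j * coeff (\<Prod>i<L. [:- x i, 1:]) j) = poly (\<Prod>i<L. [:- x i, 1:]) (x L)"
    by (simp add: poly_altdef degP mult.commute)
  also have "\<dots> = (\<Prod>i<L. x L - x i)" by (simp add: poly_prod)
  also have "vandermonde_det L x * \<dots> =
      (\<Prod>(i, j) \<in> {(i, j). i < j \<and> j < L}. x j - x i) * (\<Prod>(i, j) \<in> {..<L} \<times> {L}. x j - x i)"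
    by (simp add: Suc.IH[OF inj] flip: prod.cartesian_product)
  also have "\<dots> = (\<Prod>(i, j) \<in> {(i, j). i < j \<and> j < L} \<union> {..<L} \<times> {L}. x j - x i)"
    by (subst prod.union_disjoint)
       (auto intro: finite_subset[of _ "{..<L} \<times> {..<L}"])
  also have "{(i, j). i < j \<and> j < L} \<union> {..<L} \<times> {L} = {(i, j). i < j \<and> j < Suc L}"
    by auto
  finally show ?case .
qed

text \<open>For \<open>p = \<Prod>i<L. (X - \<theta>\<^sub>i)\<close> this is the sum of \<open>e\<^sub>k(\<theta>) * (n - k)! / (n - L)!\<close> over \<open>k \<le> L\<close>, with \<open>k = L - j\<close>.\<close>

definition J_poly :: "nat \<Rightarrow> nat \<Rightarrow> complex poly \<Rightarrow> complex" where
  "J_poly n L p = (\<Sum>j\<le>L. (-1) ^ (L + j) * (fact (n - L + j) / fact (n - L)) * coeff p j)"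

text \<open>Border the Vandermonde matrix by the row of values at the powers of \<open>X\<close> of the linear functional
  which annihilates all polynomials \<open>(n - L + j + 1 + X) * X ^ j\<close>. Column operations turn the bordered
  matrix into the matrix defining \<open>J_ratio\<close>, bordered by a unit vector.\<close>

lemma J_ratio_eq_J_poly:
  assumes inj: "inj_on x {..<L}" and L: "L \<le> n"
  shows "J_ratio (int n) L x = J_poly n L (\<Prod>i<L. [:- x i, 1:])"
proof -
  define c :: "nat \<Rightarrow> complex" where "c j = of_nat (n - L + Suc j)" for j
  \<comment> \<open>The solution of \<open>F (Suc j) = - c j * F j\<close> with
    \<open>F 0 = 1\<close>, that is, the values of the annihilating functional.\<close>
  define F :: "nat \<Rightarrow> complex" where "F j = (-1) ^ j * (fact (n - L + j) / fact (n - L))" for j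
  have F0: "F 0 = 1" by (simp add: F_def)
  have FS: "F (Suc j) = - c j * F j" for j by (simp add: F_def c_def field_simps)
  let ?B = "vandermonde_row L x F"
  \<comment> \<open>Right multiplication by \<open>U\<close> adds \<open>c j\<close> times column
    \<open>j\<close> to column \<open>Suc j\<close>, for all \<open>j\<close>
    simultaneously.\<close>
  define U where "U = mat (Suc L) (Suc L) (\<lambda>(i, j). if i = j then 1 else if Suc i = j then c i else 0)"
  let ?D = "mat L L (\<lambda>(i, j). (of_int (int n) - of_nat L + of_nat (j + 1) + x i) * x i ^ j)"
  have B: "?B \<in> carrier_mat (Suc L) (Suc L)" and U: "U \<in> carrier_mat (Suc L) (Suc L)"
    by (auto simp: vandermonde_row_def U_def)
  have BU: "?B * U \<in> carrier_mat (Suc L) (Suc L)" using B U by auto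
  have detU: "Determinant.det U = 1"
    by (subst det_upper_triangular[OF _ U])
       (auto simp: U_def upper_triangular_def prod_list_diag_prod)
  have idx0: "(?B * U) $$ (i, 0) = ?B $$ (i, 0)" if "i \<le> L" for i
  proof -
    have "(?B * U) $$ (i, 0) = (\<Sum>k\<in>{0..<Suc L}. ?B $$ (i, k) * U $$ (k, 0))"
      using B U that by (simp add: scalar_prod_def)
    also have "\<dots> = (\<Sum>k\<in>{0..<Suc L}. if k = 0 then ?B $$ (i, 0) else 0)"
      by (intro sum.cong refl) (auto simp: U_def)
    finally show ?thesis by simp
  qed
  have idxS: "(?B * U) $$ (i, Suc j) = ?B $$ (i, Suc j) + c j * ?B $$ (i, j)" if "i \<le> L" "j < L" for i j
  proof -
    have "(?B * U) $$ (i, Suc j) = (\<Sum>k\<in>{0..<Suc L}. ?B $$ (i, k) * U $$ (k, Suc j))"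
      using B U that by (simp add: scalar_prod_def)
    also have "\<dots> = (\<Sum>k\<in>{0..<Suc L}. (if k = Suc j then ?B $$ (i, Suc j) else 0)
        + (if k = j then c j * ?B $$ (i, j) else 0))"
      using that by (intro sum.cong refl) (auto simp: U_def)
    finally show ?thesis using that by (simp add: sum.distrib)
  qed
  have last: "(?B * U) $$ (L, j) = (if j = 0 then 1 else 0)" if "j \<le> L" for j
  proof (cases j)
    case 0
    thus ?thesis using idx0[of L] by (simp add: vandermonde_row_def F0)
  next
    case (Suc k)
    thus ?thesis using idxS[of L k] that by (simp add: vandermonde_row_def FS)
  qed
  \<comment> \<open>Deleting column 0 shifts the column index by one, so column \<open>j\<close>
    holds \<open>x i ^ Suc j + c j * x i ^ j\<close>. The assumption \<open>L \<le> n\<close>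
    reconciles truncated subtraction in \<open>c\<close> with the integer difference.\<close>
  have del: "mat_delete (?B * U) L 0 = ?D"
  proof (rule eq_matI)
    fix i j assume "i < dim_row ?D" "j < dim_col ?D"
    hence ij: "i < L" "j < L" by auto
    have "mat_delete (?B * U) L 0 $$ (i, j) = (?B * U) $$ (i, Suc j)"
      using ij B U by (simp add: mat_delete_def)
    also have "\<dots> = x i ^ Suc j + c j * x i ^ j"
      using ij idxS[of i j] by (simp add: vandermonde_row_def)
    finally show "mat_delete (?B * U) L 0 $$ (i, j) = ?D $$ (i, j)"
      using ij L by (simp add: c_def algebra_simps of_nat_diff)
  qed (use B U in auto)
  \<comment> \<open>The border row has become a unit vector, so a single cofactor survives, with
    sign \<open>(-1) ^ L\<close>.\<close>
  have "Determinant.det (?B * U) = (\<Sum>j<Suc L. (?B * U) $$ (L, j) * cofactor (?B * U) L j)"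
    by (rule laplace_expansion_row[OF BU]) simp
  also have "\<dots> = (\<Sum>j<Suc L. if j = 0 then cofactor (?B * U) L 0 else 0)"
    by (intro sum.cong refl) (simp add: last less_Suc_eq_le)
  also have "\<dots> = cofactor (?B * U) L 0" by (subst sum.delta) auto
  also have "\<dots> = (-1) ^ L * Determinant.det ?D" unfolding cofactor_def del by simp
  finally have "(-1) ^ L * Determinant.det ?D = Determinant.det ?B"
    by (simp add: det_mult[OF B U] detU)
  hence "(-1) ^ L * ((-1) ^ L * Determinant.det ?D) = (-1) ^ L * Determinant.det ?B" by simp
  hence "Determinant.det ?D = (-1) ^ L * Determinant.det ?B"
    by (simp flip: mult.assoc power_mult_distrib)
  also have "\<dots> = vandermonde_det L x * J_poly n L (\<Prod>i<L. [:- x i, 1:])"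
    by (simp add: det_vandermonde_row[OF inj] J_poly_def F_def sum_distrib_left power_add mult_ac)
  finally have D: "Determinant.det ?D = vandermonde_det L x * J_poly n L (\<Prod>i<L. [:- x i, 1:])" .
  have fin: "finite {(i, j). i < j \<and> j < L}"
    by (rule finite_subset[of _ "{..<L} \<times> {..<L}"]) auto
  have "x j - x i \<noteq> 0" if "i < j" "j < L" for i j
    using inj_onD[OF inj, of i j] that by auto
  hence "vandermonde_det L x \<noteq> 0"
    unfolding vandermonde_det_eq[OF inj] prod_zero_iff[OF fin] by auto
  thus ?thesis unfolding J_ratio_def D vandermonde_det_eq[OF inj, symmetric] by simp
qed

section \<open>Coinciding arguments of J: continuity and limits\<close>

lemma coeff_linear_mult:
  fixes p :: "'a :: comm_ring_1 poly"
  shows "coeff ([:a, 1:] * p) j = a * coeff p j + (case j of 0 \<Rightarrow> 0 | Suc k \<Rightarrow> coeff p k)"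
  by (cases j) (simp_all add: mult_pCons_left)

text \<open>The coefficients depend polynomially on the roots; the recursion
  \<open>coeff_linear_mult\<close> passes to the limit term by term.\<close>

lemma tendsto_coeff_prod_linear:
  fixes f :: "'b \<Rightarrow> nat \<Rightarrow> 'a :: real_normed_field"
  assumes "\<And>i. ((\<lambda>y. f y i) \<longlongrightarrow> x i) T"
  shows "((\<lambda>y. coeff (\<Prod>i<L. [:- f y i, 1:]) j) \<longlongrightarrow> coeff (\<Prod>i<L. [:- x i, 1:]) j) T"
proof (induction L arbitrary: j)
  case (Suc L)
  show ?case
    unfolding prod.lessThan_Suc mult.commute[of _ "[:_, 1:]"] coeff_linear_mult
    by (cases j) (auto intro!: tendsto_intros assms Suc.IH)
qed simp

text \<open>This makes the \<open>Lim\<close> in \<open>J_fun\<close> meaningful. Moving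
  \<open>x i\<close> to \<open>x i + e * i\<close> for \<open>i < L\<close> separates all
  coordinates for small nonzero \<open>e\<close> and tends to \<open>x\<close>, so injective points
  accumulate at \<open>x\<close>.\<close>

lemma at_within_inj_nontrivial:
  fixes x :: "nat \<Rightarrow> complex"
  assumes x0: "\<And>i. i \<ge> L \<Longrightarrow> x i = 0" and notinj: "\<not> inj_on x {..<L}"
  shows "at x within {y. inj_on y {..<L} \<and> (\<forall>i\<ge>L. y i = 0)} \<noteq> bot"
proof
  let ?S = "{y::nat \<Rightarrow> complex. inj_on y {..<L} \<and> (\<forall>i\<ge>L. y i = 0)}"
  assume bot: "at x within ?S = bot"
  define g where "g e i = x i + complex_of_real e * (if i < L then of_nat i else 0)" for e i
  have "continuous_on UNIV g"
    unfolding g_def by (intro continuous_on_coordinatewise_then_product continuous_intros)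
  hence "(g \<longlongrightarrow> g 0) (at 0)"
    by (simp add: continuous_on_def)
  moreover have "g 0 = x" by (simp add: g_def fun_eq_iff)
  ultimately have tend: "(g \<longlongrightarrow> x) (at 0)" by simp
  have "\<forall>\<^sub>F e in at 0. \<forall>(i, j)\<in>{..<L} \<times> {..<L}. i \<noteq> j \<longrightarrow> g e i \<noteq> g e j"
  proof (rule eventually_ball_finite)
    show "\<forall>ij\<in>{..<L} \<times> {..<L}. \<forall>\<^sub>F e in at 0. case ij of (i, j) \<Rightarrow> i \<noteq> j \<longrightarrow> g e i \<noteq> g e j"
    proof safe
      fix i j assume ij: "i < L" "j < L"
      \<comment> \<open>A collision of two different coordinates determines \<open>e\<close>, hence
        happens for at most this real value.\<close>
      let ?a = "Re ((x i - x j) / (of_nat j - of_nat i))"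
      have "\<forall>\<^sub>F e in at 0. e \<noteq> ?a" by (rule eventually_neq_at_within)
      thus "\<forall>\<^sub>F e in at 0. i \<noteq> j \<longrightarrow> g e i \<noteq> g e j"
      proof eventually_elim
        case (elim e)
        show ?case
        proof (intro impI notI)
          assume "i \<noteq> j" "g e i = g e j"
          hence "complex_of_real e * (of_nat j - of_nat i) = x i - x j" and "of_nat j - of_nat i \<noteq> (0::complex)"
            using ij by (auto simp: g_def algebra_simps)
          hence "complex_of_real e = (x i - x j) / (of_nat j - of_nat i)"
            by (simp add: nonzero_eq_divide_eq)
          hence "e = ?a" by (metis Re_complex_of_real)
          thus False using elim by simp
        qed
      qed
    qed
  qed simp
  hence "\<forall>\<^sub>F e in at 0. g e \<in> ?S \<and> g e \<noteq> x"
  proof eventually_elim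
    case (elim e)
    hence "inj_on (g e) {..<L}" by (auto simp: inj_on_def)
    \<comment> \<open>The point \<open>x\<close> itself has a collision, so \<open>g e\<close>
      differs from it, as the punctured filter requires.\<close>
    thus ?case using notinj by (auto simp: g_def x0)
  qed
  hence "filterlim g (at x within ?S) (at 0)"
    using tend by (simp add: filterlim_at eventually_conj_iff)
  hence "filterlim g bot (at (0::real))" unfolding bot .
  hence "at (0::real) = bot" by (simp add: filterlim_def filtermap_bot_iff bot_unique)
  thus False by simp
qed

text \<open>For coinciding arguments, \<open>J_ratio\<close> equals \<open>J_poly\<close> at the
  injective points nearby, and \<open>J_poly\<close> is continuous in the roots, so the limit is its
  value.\<close>

lemma J_fun_eq_J_poly:
  assumes L: "length ths \<le> n"
  shows "J_fun (int n) ths = J_poly n (length ths) (\<Prod>x\<leftarrow>ths. [:- x, 1:])"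
proof -
  define L where "L = length ths"
  define x where "x = (\<lambda>i. if i < L then ths ! i else 0)"
  have "(\<Prod>x\<leftarrow>ths. [:- x, 1:]) = (\<Prod>i<L. [:- x i, 1:])"
    unfolding L_def x_def by (subst prod.list_conv_set_nth) (simp add: atLeast0LessThan)
  moreover have "J_fun (int n) ths = J_poly n L (\<Prod>i<L. [:- x i, 1:])"
  proof (cases "distinct ths")
    case True
    hence "inj_on x {..<L}" by (auto simp: inj_on_def x_def L_def nth_eq_iff_index_eq)
    thus ?thesis
      using True L by (simp add: J_fun_def Let_def J_ratio_eq_J_poly flip: L_def x_def)
  next
    case False
    hence ninj: "\<not> inj_on x {..<L}" by (auto simp: inj_on_def x_def L_def distinct_conv_nth)
    let ?S = "{y::nat \<Rightarrow> complex. inj_on y {..<L} \<and> (\<forall>i\<ge>L. y i = 0)}"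
    have "((\<lambda>y. y i) \<longlongrightarrow> x i) (at x within ?S)" for i
    proof -
      have "continuous_on UNIV (\<lambda>y::nat \<Rightarrow> complex. y i)" by simp
      hence "((\<lambda>y. y i) \<longlongrightarrow> x i) (at x)" by (simp add: continuous_on_def)
      thus ?thesis by (rule tendsto_within_subset) simp
    qed
    hence "((\<lambda>y. J_poly n L (\<Prod>i<L. [:- y i, 1:])) \<longlongrightarrow> J_poly n L (\<Prod>i<L. [:- x i, 1:])) (at x within ?S)"
      unfolding J_poly_def by (intro tendsto_intros tendsto_coeff_prod_linear)
    moreover have "\<forall>\<^sub>F y in at x within ?S. J_poly n L (\<Prod>i<L. [:- y i, 1:]) = J_ratio (int n) L y"
      using L by (auto simp: eventually_at_filter J_ratio_eq_J_poly L_def)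
    ultimately have "(J_ratio (int n) L \<longlongrightarrow> J_poly n L (\<Prod>i<L. [:- x i, 1:])) (at x within ?S)"
      by (rule Lim_transform_eventually)
    hence "Lim (at x within ?S) (J_ratio (int n) L) = J_poly n L (\<Prod>i<L. [:- x i, 1:])"
      by (intro tendsto_Lim at_within_inj_nontrivial ninj) (simp_all add: x_def)
    thus ?thesis using False by (simp add: J_fun_def Let_def flip: L_def x_def)
  qed
  ultimately show ?thesis by (simp add: L_def)
qed

text \<open>The ordering picked by \<open>SOME\<close> is immaterial, because \<open>J_poly\<close>
  sees only the product over the multiset.\<close>

lemma J_mset_eq_J_poly:
  assumes "size A \<le> n"
  shows "J_mset (int n) A = J_poly n (size A) (\<Prod>x\<in>#A. [:- x, 1:])"
proof -
  define xs where "xs = (SOME xs. mset xs = A)"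
  have "mset xs = A" unfolding xs_def by (rule someI_ex) (rule ex_mset)
  moreover from this have "size A = length xs" "(\<Prod>x\<in>#A. [:- x, 1:]) = (\<Prod>x\<leftarrow>xs. [:- x, 1:])"
    by (auto simp flip: prod_mset_prod_list)
  ultimately show ?thesis
    using assms unfolding J_mset_def xs_def[symmetric] by (simp add: J_fun_eq_J_poly)
qed

subsection \<open>Gram determinants and matrix pencils\<close>

text \<open>A symmetrised Cauchy-Binet formula: the squared moduli of the determinants
  \<open>D f\<close>, summed over all row assignments \<open>f\<close>, give
  \<open>fact (card Q)\<close> times the Gram determinant.\<close>

lemma nonneg_Reals_pdet_gram:
  fixes g :: "'b \<Rightarrow> 'i \<Rightarrow> complex"
  assumes fin: "finite Q" "finite N"
  shows "pdet Q (\<lambda>i j. \<Sum>r\<in>N. cnj (g r i) * g r j) \<in> \<real>\<^sub>\<ge>\<^sub>0"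
proof -
  let ?\<Gamma> = "\<lambda>i j. \<Sum>r\<in>N. cnj (g r i) * g r j"
  let ?P = "{p. p permutes Q}"
  define D where "D f = (\<Sum>p\<in>?P. of_int (sign p) * (\<Prod>j\<in>Q. g (f j) (p j)))" for f
  have "(\<Sum>f\<in>Q \<rightarrow>\<^sub>E N. cnj (D f) * D f) =
    (\<Sum>f\<in>Q \<rightarrow>\<^sub>E N. \<Sum>t\<in>?P. \<Sum>s\<in>?P. of_int (sign s) * of_int (sign t) *
       (\<Prod>j\<in>Q. cnj (g (f j) (s j)) * g (f j) (t j)))"
    unfolding D_def cnj_sum sum_product
    by (subst sum.swap) (simp add: prod.distrib mult_ac)
  also have "\<dots> = (\<Sum>t\<in>?P. \<Sum>s\<in>?P. \<Sum>f\<in>Q \<rightarrow>\<^sub>E N. of_int (sign s) * of_int (sign t) *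
       (\<Prod>j\<in>Q. cnj (g (f j) (s j)) * g (f j) (t j)))"
    by (subst sum.swap, intro sum.cong refl, rule sum.swap)
  also have "\<dots> = (\<Sum>t\<in>?P. \<Sum>s\<in>?P. of_int (sign s) * of_int (sign t) * (\<Prod>j\<in>Q. ?\<Gamma> (s j) (t j)))"
    by (intro sum.cong refl) (simp add: prod_sum_PiE fin sum_distrib_left)
  also have "\<dots> = (\<Sum>t\<in>?P. pdet Q ?\<Gamma>)"
  proof (intro sum.cong refl)
    fix t assume "t \<in> ?P"
    hence t: "t permutes Q" by simp
    \<comment> \<open>Replacing \<open>s\<close> by \<open>s \<circ> t\<close> absorbs
      \<open>t\<close>, so every \<open>t\<close> contributes the same value.\<close>
    have "(\<Sum>s\<in>?P. of_int (sign s) * of_int (sign t) * (\<Prod>j\<in>Q. ?\<Gamma> (s j) (t j))) =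
      (\<Sum>s\<in>?P. of_int (sign (s \<circ> t)) * of_int (sign t) * (\<Prod>j\<in>Q. ?\<Gamma> ((s \<circ> t) j) (t j)))"
      by (rule sum_permutations_compose_right[OF t])
    also have "\<dots> = pdet Q ?\<Gamma>"
      unfolding pdet_def
    proof (intro sum.cong refl)
      fix s assume "s \<in> ?P"
      hence s: "s permutes Q" by simp
      have "sign (s \<circ> t) = sign s * sign t"
        using s t fin by (simp add: sign_compose permutes_imp_permutation)
      moreover have "sign t * sign t = 1" by (simp add: sign_idempotent)
      ultimately have "of_int (sign (s \<circ> t)) * of_int (sign t) = (of_int (sign s) :: complex)"
        by (metis mult.assoc mult.right_neutral of_int_mult)
      moreover have "(\<Prod>j\<in>Q. ?\<Gamma> ((s \<circ> t) j) (t j)) = (\<Prod>j\<in>Q. ?\<Gamma> (s j) j)"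
        using prod.permute[OF t, of "\<lambda>j. ?\<Gamma> (s j) j"] by (simp add: o_def)
      ultimately show "of_int (sign (s \<circ> t)) * of_int (sign t) * (\<Prod>j\<in>Q. ?\<Gamma> ((s \<circ> t) j) (t j)) =
          of_int (sign s) * (\<Prod>j\<in>Q. ?\<Gamma> (s j) j)" by simp
    qed
    finally show "(\<Sum>s\<in>?P. of_int (sign s) * of_int (sign t) * (\<Prod>j\<in>Q. ?\<Gamma> (s j) (t j))) = pdet Q ?\<Gamma>" .
  qed
  also have "\<dots> = of_nat (fact (card Q)) * pdet Q ?\<Gamma>"
    by (simp add: card_permutations[OF refl fin(1)])
  finally have eq: "pdet Q ?\<Gamma> = (\<Sum>f\<in>Q \<rightarrow>\<^sub>E N. cnj (D f) * D f) / of_nat (fact (card Q))"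
    by simp
  have "cnj (D f) * D f = of_real ((cmod (D f))\<^sup>2)" for f
    using complex_norm_square[of "D f"] by (simp add: mult.commute)
  hence "pdet Q ?\<Gamma> = of_real ((\<Sum>f\<in>Q \<rightarrow>\<^sub>E N. (cmod (D f))\<^sup>2) / fact (card Q))"
    by (simp add: eq)
  thus ?thesis by (simp only: nonneg_Reals_of_real_iff) (simp add: sum_nonneg)
qed

text \<open>Sylvester's identity: \<open>?X * ?Y\<close> and \<open>?Y * ?X\<close> are both block
  lower triangular, each showing one of the two determinants, and the determinant is
  multiplicative.\<close>

lemma det_one_add_mult_commute:
  fixes A B :: "'a :: field mat"
  assumes A: "A \<in> carrier_mat n m" and B: "B \<in> carrier_mat m n"
  shows "Determinant.det (1\<^sub>m n + A * B) = Determinant.det (1\<^sub>m m + B * A)"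
proof -
  let ?X = "four_block_mat (1\<^sub>m n) (- A) B (1\<^sub>m m)"
  let ?Y = "four_block_mat (1\<^sub>m n) A (0\<^sub>m m n) (1\<^sub>m m)"
  have X: "?X \<in> carrier_mat (n + m) (n + m)" and Y: "?Y \<in> carrier_mat (n + m) (n + m)"
    by auto
  have "?X * ?Y = four_block_mat (1\<^sub>m n * 1\<^sub>m n + - A * 0\<^sub>m m n) (1\<^sub>m n * A + - A * 1\<^sub>m m)
      (B * 1\<^sub>m n + 1\<^sub>m m * 0\<^sub>m m n) (B * A + 1\<^sub>m m * 1\<^sub>m m)"
    by (rule mult_four_block_mat) (use A B in auto)
  also have "\<dots> = four_block_mat (1\<^sub>m n) (0\<^sub>m n m) B (1\<^sub>m m + B * A)"
    using A B by (intro arg_cong4[of _ _ _ _ _ _ _ _ four_block_mat])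
      (auto simp: comm_add_mat[of _ m m])
  finally have XY: "?X * ?Y = four_block_mat (1\<^sub>m n) (0\<^sub>m n m) B (1\<^sub>m m + B * A)" .
  have "?Y * ?X = four_block_mat (1\<^sub>m n * 1\<^sub>m n + A * B) (1\<^sub>m n * - A + A * 1\<^sub>m m)
      (0\<^sub>m m n * 1\<^sub>m n + 1\<^sub>m m * B) (0\<^sub>m m n * - A + 1\<^sub>m m * 1\<^sub>m m)"
    by (rule mult_four_block_mat) (use A B in auto)
  also have "\<dots> = four_block_mat (1\<^sub>m n + A * B) (0\<^sub>m n m) B (1\<^sub>m m)"
    using A B by (intro arg_cong4[of _ _ _ _ _ _ _ _ four_block_mat]) auto
  finally have YX: "?Y * ?X = four_block_mat (1\<^sub>m n + A * B) (0\<^sub>m n m) B (1\<^sub>m m)" .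
  have "Determinant.det (?X * ?Y) = Determinant.det (1\<^sub>m m + B * A)"
    unfolding XY by (subst det_four_block_mat_upper_right_zero[OF _ refl]) (use A B in auto)
  moreover have "Determinant.det (?Y * ?X) = Determinant.det (1\<^sub>m n + A * B)"
    unfolding YX by (subst det_four_block_mat_upper_right_zero[OF _ refl]) (use A B in auto)
  ultimately show ?thesis
    using det_mult[OF X Y] det_mult[OF Y X] by (simp add: mult.commute)
qed

text \<open>The monomial accounts for \<open>t - L\<close> zero eigenvalues. It shifts the
  coefficients but preserves signs and the factorials in the numerators, so only the normalisation
  changes; this is the source of the factorial quotient in the bound.\<close>

lemma J_poly_shift:
  assumes "L \<le> t" "t \<le> n"
  shows "J_poly n t (monom 1 (t - L) * p) = J_poly n L p * (fact (n - L) / fact (n - t))"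
proof -
  have "J_poly n t (monom 1 (t - L) * p) = (\<Sum>m\<in>{t-L..t}. (-1) ^ (t + m) *
      (fact (n - t + m) / fact (n - t)) * coeff p (m - (t - L)))"
    unfolding J_poly_def coeff_monom_mult
    by (rule sum.mono_neutral_cong_right) auto
  also have "\<dots> = (\<Sum>j\<le>L. (-1) ^ (t + (j + (t - L))) *
      (fact (n - t + (j + (t - L))) / fact (n - t)) * coeff p j)"
    by (rule sum.reindex_bij_witness[where i = "\<lambda>j. j + (t - L)" and j = "\<lambda>m. m - (t - L)"])
       (use assms in auto)
  also have "\<dots> = (\<Sum>j\<le>L. (-1) ^ (L + j) * (fact (n - L + j) / fact (n - L)) * coeff p j * (fact (n - L) / fact (n - t)))"
  proof (intro sum.cong refl)
    fix j
    have a: "(-1) ^ (t + (j + (t - L))) = ((-1) ^ (L + j) :: complex)"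
    proof -
      have "t + (j + (t - L)) = L + j + 2 * (t - L)" using assms(1) by simp
      thus ?thesis by (simp only: power_add power_mult) simp
    qed
    have b: "n - t + (j + (t - L)) = n - L + j" using assms by simp
    show "(-1) ^ (t + (j + (t - L))) * (fact (n - t + (j + (t - L))) / fact (n - t)) * coeff p j =
       (-1) ^ (L + j) * (fact (n - L + j) / fact (n - L)) * coeff p j * (fact (n - L) / fact (n - t))"
      unfolding a b by simp
  qed
  finally show ?thesis unfolding J_poly_def[of n L] sum_distrib_right .
qed

lemma J_poly_sum: "finite A \<Longrightarrow> J_poly n t (\<Sum>k\<in>A. p k) = (\<Sum>k\<in>A. J_poly n t (p k))"
  unfolding J_poly_def coeff_sum sum_distrib_left by (rule sum.swap)

lemma J_poly_smult: "J_poly n t (Polynomial.smult c p) = c * J_poly n t p"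
  unfolding J_poly_def by (simp add: sum_distrib_left mult_ac)

lemma J_poly_monom:
  assumes "k \<le> t"
  shows "J_poly n t (monom c k) = (-1) ^ (t + k) * (fact (n - t + k) / fact (n - t)) * c"
  unfolding J_poly_def using assms by (simp add: if_distrib sum.delta cong: if_cong)

text \<open>The characteristic polynomial is monic and splits over the complex numbers; its roots at
  0 are collected in the monomial.\<close>

lemma char_poly_eq_nonzero_eigs:
  assumes A: "A \<in> carrier_mat t t"
  shows "size (nonzero_eigs A) \<le> t"
    and "char_poly A = monom 1 (t - size (nonzero_eigs A)) * (\<Prod>x\<in>#nonzero_eigs A. [:- x, 1:])"
proof -
  let ?E = "proots (char_poly A)"
  have deg: "degree (char_poly A) = t" and lead: "lead_coeff (char_poly A) = 1"
    using degree_monic_char_poly[OF A] by auto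
  have E: "?E = nonzero_eigs A + replicate_mset (count ?E 0) 0"
    unfolding nonzero_eigs_def by (rule multiset_eqI) (auto simp: count_filter_mset)
  have "size ?E = t" by (simp add: size_proots_complex deg)
  hence sz: "size (nonzero_eigs A) + count ?E 0 = t"
    using E by (metis size_replicate_mset size_union)
  thus "size (nonzero_eigs A) \<le> t" by simp
  have "char_poly A = (\<Prod>x\<in>#?E. [:- x, 1:])"
    using complex_poly_decompose_multiset[of "char_poly A"] lead by simp
  also have "\<dots> = [:0, 1:] ^ count ?E 0 * (\<Prod>x\<in>#nonzero_eigs A. [:- x, 1:])"
    by (subst E) (simp add: mult.commute)
  also have "[:0, 1:] ^ count ?E 0 = (monom 1 (count ?E 0) :: complex poly)"
    by (simp add: monom_altdef)
  finally show "char_poly A = monom 1 (t - size (nonzero_eigs A)) * (\<Prod>x\<in>#nonzero_eigs A. [:- x, 1:])"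
    using sz by (metis add_diff_cancel_left')
qed

lemma the_mat_inverse:
  assumes P: "P \<in> carrier_mat t t" and det: "Determinant.det P \<noteq> (0 :: 'a :: field)"
  shows "P * the (mat_inverse P) = 1\<^sub>m t" "the (mat_inverse P) \<in> carrier_mat t t"
proof -
  have "mat_inverse P \<noteq> None"
    using mat_inverse(1)[OF P, where b = "()"] det_non_zero_imp_unit[OF P det, where b = "()"] by blast
  thus "P * the (mat_inverse P) = 1\<^sub>m t" "the (mat_inverse P) \<in> carrier_mat t t"
    using mat_inverse(2)[OF P] by auto
qed

text \<open>At a point \<open>z\<close> the left side is
  \<open>det P * det (z I - P^-1 S) = det (z P - S)\<close>, which is expanded by columns:
  \<open>K\<close> collects those from \<open>Sigma\<close>, each with a factor -1, and each
  remaining column brings a factor \<open>z\<close>.\<close>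

lemma det_mult_char_poly_eq_pencil:
  fixes Psi Sigma :: "complex mat"
  assumes Psi: "Psi \<in> carrier_mat N N" and Sigma: "Sigma \<in> carrier_mat N N" and Q: "Q \<subseteq> {..<N}"
    and det: "Determinant.det (principal Psi Q) \<noteq> 0"
  shows "Polynomial.smult (Determinant.det (principal Psi Q))
      (char_poly (the (mat_inverse (principal Psi Q)) * principal Sigma Q)) =
    (\<Sum>K\<in>Pow Q. monom ((-1) ^ card K * pdet Q (\<lambda>i j. if j \<in> K then Sigma $$ (i, j) else Psi $$ (i, j)))
       (card Q - card K))" (is "?l = ?r")
proof (rule poly_eq_poly_eq_iff[THEN iffD1], rule ext)
  fix z
  let ?t = "card Q" and ?P = "principal Psi Q" and ?S = "principal Sigma Q"
  let ?A = "the (mat_inverse ?P) * ?S"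
  have fin: "finite Q" using Q finite_subset by auto
  have P: "?P \<in> carrier_mat ?t ?t" and S: "?S \<in> carrier_mat ?t ?t"
    using principal_carrier assms by auto
  note inv = the_mat_inverse[OF P det]
  have A: "?A \<in> carrier_mat ?t ?t" using inv S by auto
  have PA: "?P * ?A = ?S"
    using inv S P by (simp flip: assoc_mult_mat[of _ ?t ?t _ ?t _ ?t])
  have "- char_matrix B z = z \<cdot>\<^sub>m 1\<^sub>m ?t - B" if "B \<in> carrier_mat ?t ?t" for B :: "complex mat"
    using that by (intro eq_matI) (auto simp: char_matrix_def)
  note ch = this[OF A]
  have "poly ?l z = Determinant.det ?P * Determinant.det (z \<cdot>\<^sub>m 1\<^sub>m ?t - ?A)"
    by (simp add: char_poly_matrix[OF A] ch)
  also have "\<dots> = Determinant.det (?P * (z \<cdot>\<^sub>m 1\<^sub>m ?t - ?A))"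
    by (rule det_mult[OF P minus_carrier_mat[OF A], symmetric])
  also have "?P * (z \<cdot>\<^sub>m 1\<^sub>m ?t - ?A) = z \<cdot>\<^sub>m ?P - ?S"
    using P PA mult_smult_distrib[OF P one_carrier_mat, of z] by (simp add: mult_minus_distrib_mat[OF P _ A])
  also have "Determinant.det \<dots> = pdet {..<?t} (\<lambda>i j. z * Psi $$ (pick Q i, pick Q j) - Sigma $$ (pick Q i, pick Q j))"
    using P S by (subst det_eq_pdet[of _ ?t])
      (auto intro!: pdet_cong simp: principal_index[OF Psi Q] principal_index[OF Sigma Q])
  also have "\<dots> = pdet Q (\<lambda>i j. Psi $$ (i, j) * z + - Sigma $$ (i, j))"
    using pdet_pick[OF Q, of "\<lambda>i j. Psi $$ (i, j) * z + - Sigma $$ (i, j)"] by (simp add: mult.commute)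
  also have "\<dots> = (\<Sum>K\<in>Pow Q. pdet Q (\<lambda>i j. if j \<in> K then - Sigma $$ (i, j) else Psi $$ (i, j) * z))"
    by (rule pdet_add[OF fin])
  also have "\<dots> = (\<Sum>K\<in>Pow Q. (-1) ^ card K * pdet Q (\<lambda>i j. if j \<in> K then Sigma $$ (i, j) else Psi $$ (i, j))
      * z ^ (?t - card K))"
  proof (intro sum.cong refl)
    fix K assume "K \<in> Pow Q"
    hence K: "K \<subseteq> Q" "finite K" using fin finite_subset by auto
    have KQ: "Q \<inter> {x. x \<in> K} = K" "Q \<inter> - {x. x \<in> K} = Q - K" using K by auto
    have cols: "(\<lambda>i j. if j \<in> K then - Sigma $$ (i, j) else Psi $$ (i, j) * z) =
      (\<lambda>i j. (if j \<in> K then Sigma $$ (i, j) else Psi $$ (i, j)) * (if j \<in> K then - 1 else z))"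
      by (auto simp: fun_eq_iff)
    have prd: "(\<Prod>j\<in>Q. if j \<in> K then - 1 else z) = (-1) ^ card K * z ^ (?t - card K)"
      by (simp only: prod.If_cases[OF fin] KQ prod_constant card_Diff_subset[OF K(2,1)])
    show "pdet Q (\<lambda>i j. if j \<in> K then - Sigma $$ (i, j) else Psi $$ (i, j) * z) =
      (-1) ^ card K * pdet Q (\<lambda>i j. if j \<in> K then Sigma $$ (i, j) else Psi $$ (i, j)) * z ^ (?t - card K)"
      unfolding cols pdet_smult_columns[OF fin] prd by (simp only: mult_ac)
  qed
  also have "\<dots> = poly ?r z"
    by (simp add: poly_sum poly_monom)
  finally show "poly ?l z = poly ?r z" .
qed

text \<open>Apply the linear functional \<open>J_poly n (card Q)\<close> to the pencil identity. On
  the left \<open>J_poly_shift\<close> absorbs the zero eigenvalues; on the right every monomial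
  yields its factorial quotient.\<close>

lemma det_mult_J_mset:
  fixes Psi Sigma :: "complex mat"
  assumes Psi: "Psi \<in> carrier_mat N N" and Sigma: "Sigma \<in> carrier_mat N N" and Q: "Q \<subseteq> {..<N}"
    and det: "Determinant.det (principal Psi Q) \<noteq> 0" and n: "card Q \<le> n"
  defines "E \<equiv> nonzero_eigs (the (mat_inverse (principal Psi Q)) * principal Sigma Q)"
  shows "Determinant.det (principal Psi Q) * J_mset (int n) E * of_real (fact (n - size E) / fact (n - card Q)) =
    (\<Sum>K\<in>Pow Q. fact (n - card K) / fact (n - card Q) *
       pdet Q (\<lambda>i j. if j \<in> K then Sigma $$ (i, j) else Psi $$ (i, j)))"
proof -
  let ?t = "card Q" and ?P = "principal Psi Q" and ?S = "principal Sigma Q"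
  let ?A = "the (mat_inverse ?P) * ?S"
  have fin: "finite Q" using Q finite_subset by auto
  have P: "?P \<in> carrier_mat ?t ?t" and S: "?S \<in> carrier_mat ?t ?t"
    using principal_carrier assms by auto
  have A: "?A \<in> carrier_mat ?t ?t" using the_mat_inverse[OF P det] S by auto
  note E = char_poly_eq_nonzero_eigs[OF A, folded E_def]
  have "Determinant.det ?P * J_mset (int n) E * of_real (fact (n - size E) / fact (n - ?t)) =
    Determinant.det ?P * (J_poly n (size E) (\<Prod>x\<in>#E. [:- x, 1:]) * (fact (n - size E) / fact (n - ?t)))"
    using E(1) n by (simp add: J_mset_eq_J_poly mult.assoc)
  also have "\<dots> = J_poly n ?t (Polynomial.smult (Determinant.det ?P) (char_poly ?A))"
    by (simp only: J_poly_shift[OF E(1) n, symmetric] E(2)[symmetric] J_poly_smult)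
  also have "\<dots> = (\<Sum>K\<in>Pow Q. J_poly n ?t (monom ((-1) ^ card K *
      pdet Q (\<lambda>i j. if j \<in> K then Sigma $$ (i, j) else Psi $$ (i, j))) (?t - card K)))"
    unfolding det_mult_char_poly_eq_pencil[OF Psi Sigma Q det] using fin by (simp add: J_poly_sum)
  also have "\<dots> = (\<Sum>K\<in>Pow Q. fact (n - card K) / fact (n - ?t) *
       pdet Q (\<lambda>i j. if j \<in> K then Sigma $$ (i, j) else Psi $$ (i, j)))"
  proof (intro sum.cong refl)
    fix K assume "K \<in> Pow Q"
    hence K: "card K \<le> ?t" using fin by (simp add: card_mono)
    \<comment> \<open>The sign of \<open>J_poly\<close> on this monomial cancels the sign of the
      pencil coefficient.\<close>
    have "(-1) ^ (?t + (?t - card K)) * (-1) ^ card K = (1 :: complex)"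
      using K by (simp flip: power_add add: mult_2[symmetric] power_mult)
    moreover have "n - ?t + (?t - card K) = n - card K" using K n by simp
    ultimately show "J_poly n ?t (monom ((-1) ^ card K *
      pdet Q (\<lambda>i j. if j \<in> K then Sigma $$ (i, j) else Psi $$ (i, j))) (?t - card K)) =
      fact (n - card K) / fact (n - ?t) * pdet Q (\<lambda>i j. if j \<in> K then Sigma $$ (i, j) else Psi $$ (i, j))"
      by (simp add: J_poly_monom mult_ac)
  qed
  finally show ?thesis .
qed

subsection \<open>Random matrices with independent entries\<close>

lemma measurable_cnj [measurable]: "cnj \<in> borel_measurable borel"
  by (intro borel_measurable_continuous_onI continuous_intros)

text \<open>Real and imaginary parts each have variance 1/2, whence the standard deviation
  \<open>1 / sqrt 2\<close>.\<close>

lemma CN_density_eq: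
  "exp (- (cmod z)\<^sup>2) / pi = normal_density 0 (1 / sqrt 2) (Re z) * normal_density 0 (1 / sqrt 2) (Im z)"
  by (simp add: normal_density_def cmod_power2 power_divide exp_diff exp_minus field_simps
      flip: exp_add)

lemma nn_integral_lborel_complex:
  assumes [measurable]: "f \<in> borel_measurable borel" "g \<in> borel_measurable borel"
  shows "(\<integral>\<^sup>+z. f (Re z) * g (Im z) \<partial>lborel) = (\<integral>\<^sup>+x. f x \<partial>lborel) * (\<integral>\<^sup>+x. g x \<partial>lborel)"
proof -
  define h where "h b = (if b = (1::complex) then f else g)" for b
  have "(\<integral>\<^sup>+z. (\<Prod>b\<in>Basis. h b (z \<bullet> b)) \<partial>lborel) = (\<Prod>b\<in>Basis. (\<integral>\<^sup>+x. h b x \<partial>lborel))"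
    by (rule nn_integral_lborel_prod) (auto simp: h_def)
  thus ?thesis by (simp add: Basis_complex_def h_def)
qed

lemma sets_CN_measure [measurable_cong, simp]: "sets CN_measure = sets borel"
  by (simp add: CN_measure_def)

lemma space_CN_measure [simp]: "space CN_measure = UNIV"
  by (simp add: CN_measure_def)

lemma nn_integral_normal_density:
  "\<sigma> > 0 \<Longrightarrow> (\<integral>\<^sup>+x. ennreal (normal_density \<mu> \<sigma> x) \<partial>lborel) = 1"
  by (simp add: nn_integral_eq_integral)

lemma nn_integral_normal_second_moment:
  "\<sigma> > 0 \<Longrightarrow> (\<integral>\<^sup>+x. ennreal (normal_density 0 \<sigma> x * x\<^sup>2) \<partial>lborel) = ennreal (\<sigma>\<^sup>2)"
  using normal_moment_even[of \<sigma> 0 1]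
  by (subst nn_integral_eq_integral)
     (auto simp: has_bochner_integral_iff power2_eq_square fact_numeral numeral_2_eq_2 intro!: arg_cong[of _ _ ennreal])

lemma prob_space_CN_measure: "prob_space CN_measure"
proof
  have "emeasure CN_measure (space CN_measure) =
    (\<integral>\<^sup>+z. ennreal (normal_density 0 (1 / sqrt 2) (Re z)) * ennreal (normal_density 0 (1 / sqrt 2) (Im z)) \<partial>lborel)"
    by (simp add: CN_measure_def emeasure_density CN_density_eq ennreal_mult)
  also have "\<dots> = 1"
    by (subst nn_integral_lborel_complex) (simp_all add: nn_integral_normal_density)
  finally show "emeasure CN_measure (space CN_measure) = 1" .
qed

lemma nn_integral_CN_measure_square: "(\<integral>\<^sup>+z. ennreal ((cmod z)\<^sup>2) \<partial>CN_measure) = 1"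
proof -
  let ?d = "normal_density 0 (1 / sqrt 2)"
  have "(\<integral>\<^sup>+z. ennreal ((cmod z)\<^sup>2) \<partial>CN_measure) =
    (\<integral>\<^sup>+z. ennreal (?d (Re z) * (Re z)\<^sup>2) * ennreal (?d (Im z)) +
          ennreal (?d (Re z)) * ennreal (?d (Im z) * (Im z)\<^sup>2) \<partial>lborel)"
  proof -
    have "ennreal (exp (- (cmod z)\<^sup>2) / pi) * ennreal ((cmod z)\<^sup>2) =
      ennreal (?d (Re z) * (Re z)\<^sup>2) * ennreal (?d (Im z)) + ennreal (?d (Re z)) * ennreal (?d (Im z) * (Im z)\<^sup>2)" for z
      unfolding CN_density_eq
      by (simp add: cmod_power2 distrib_left mult_ac flip: ennreal_mult ennreal_plus)
    thus ?thesis unfolding CN_measure_def by (subst nn_integral_density) auto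
  qed
  also have "\<dots> = (\<integral>\<^sup>+z. ennreal (?d (Re z) * (Re z)\<^sup>2) * ennreal (?d (Im z)) \<partial>lborel) +
      (\<integral>\<^sup>+z. ennreal (?d (Re z)) * ennreal (?d (Im z) * (Im z)\<^sup>2) \<partial>lborel)"
    by (rule nn_integral_add) auto
  also have "\<dots> = ennreal (1 / 2) + ennreal (1 / 2)"
    by (subst (1 2) nn_integral_lborel_complex)
       (simp_all add: nn_integral_normal_density nn_integral_normal_second_moment power_divide)
  also have "\<dots> = ennreal (1 / 2 + 1 / 2)" by (rule ennreal_plus[symmetric]) auto
  also have "\<dots> = 1" by simp
  finally show ?thesis .
qed

lemma integrable_CN_measure_square: "integrable CN_measure (\<lambda>z. (cmod z)\<^sup>2)"
  by (rule integrableI_nonneg) (auto simp: nn_integral_CN_measure_square)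

lemma integral_CN_measure_square: "(\<integral>z. (cmod z)\<^sup>2 \<partial>CN_measure) = 1"
  by (subst integral_eq_nn_integral) (auto simp: nn_integral_CN_measure_square)

text \<open>The density is even, so the integrand is odd, while Lebesgue measure is invariant under
  negation.\<close>

lemma integral_CN_measure_mean: "(\<integral>z. z \<partial>CN_measure) = 0"
proof -
  let ?f = "\<lambda>z. (exp (- (cmod z)\<^sup>2) / pi) *\<^sub>R z"
  have "(lborel :: complex measure) = distr lborel borel uminus"
    using lborel_affine[of "-1" "0::complex"] by (simp add: density_1)
  hence "(\<integral>z. ?f z \<partial>lborel) = (\<integral>z. ?f z \<partial>distr lborel borel uminus)" by simp
  also have "\<dots> = (\<integral>z. ?f (- z) \<partial>lborel)" by (rule integral_distr) auto
  also have "\<dots> = - (\<integral>z. ?f z \<partial>lborel)" by simp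
  finally have "(\<integral>z. ?f z \<partial>lborel) = 0" by simp
  thus ?thesis unfolding CN_measure_def by (subst integral_density) auto
qed

text \<open>Indexing by pairs lets whole rows serve as independent blocks. The two Gaussian matrices
  are later placed side by side in one such \<open>W\<close>, so that each row of the channel is
  affine in the same row of \<open>W\<close>.\<close>

locale white_matrix = prob_space +
  fixes W :: "nat \<times> nat \<Rightarrow> 'a \<Rightarrow> complex" and n m :: nat
  assumes indep: "indep_vars (\<lambda>_. borel) W ({..<n} \<times> {..<m})"
    and integrable_square: "\<And>i. i \<in> {..<n} \<times> {..<m} \<Longrightarrow> integrable M (\<lambda>\<omega>. (cmod (W i \<omega>))\<^sup>2)"
    and mean: "\<And>i. i \<in> {..<n} \<times> {..<m} \<Longrightarrow> expectation (W i) = 0"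
    and variance: "\<And>i. i \<in> {..<n} \<times> {..<m} \<Longrightarrow> expectation (\<lambda>\<omega>. (cmod (W i \<omega>))\<^sup>2) = 1"
begin

lemma measurable_W: "i \<in> {..<n} \<times> {..<m} \<Longrightarrow> W i \<in> borel_measurable M"
  using indep by (auto simp: indep_vars_def)

lemma integrable_W: "i \<in> {..<n} \<times> {..<m} \<Longrightarrow> integrable M (W i)"
proof (rule Bochner_Integration.integrable_bound[of _ "\<lambda>\<omega>. 1 + (cmod (W i \<omega>))\<^sup>2"])
  assume i: "i \<in> {..<n} \<times> {..<m}"
  show "integrable M (\<lambda>\<omega>. 1 + (cmod (W i \<omega>))\<^sup>2)" using integrable_square[OF i] by simp
  have "x \<le> 1 + x\<^sup>2" if "x \<ge> 0" for x :: real
    using self_le_power[of x 2] that by (cases "x \<ge> 1") (auto intro: order_trans[of x 1])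
  thus "AE \<omega> in M. norm (W i \<omega>) \<le> norm (1 + (cmod (W i \<omega>))\<^sup>2)" by (intro AE_I2) simp
qed (rule measurable_W)

lemma W_products:
  assumes i: "i \<in> {..<n} \<times> {..<m}" and j: "j \<in> {..<n} \<times> {..<m}"
  shows "integrable M (\<lambda>\<omega>. cnj (W i \<omega>) * W j \<omega>)"
    and "expectation (\<lambda>\<omega>. cnj (W i \<omega>) * W j \<omega>) = (if i = j then 1 else 0)"
proof -
  have "integrable M (\<lambda>\<omega>. cnj (W i \<omega>) * W j \<omega>) \<and>
     expectation (\<lambda>\<omega>. cnj (W i \<omega>) * W j \<omega>) = (if i = j then 1 else 0)"
  proof (cases "i = j")
    case True
    have "cnj (W i \<omega>) * W i \<omega> = complex_of_real ((cmod (W i \<omega>))\<^sup>2)" for \<omega>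
      using complex_norm_square[of "W i \<omega>"] by (simp add: mult.commute)
    thus ?thesis using True integrable_square[OF i] variance[OF i]
      by (simp del: of_real_power)
  next
    case False
    \<comment> \<open>Conjugates only the coordinate \<open>i\<close>, which turns the mixed product
      into a product of independent factors.\<close>
    define Y where "Y k = (if k = i then cnj else (\<lambda>z. z))" for k
    have "indep_vars (\<lambda>_. borel) (\<lambda>k \<omega>. Y k (W k \<omega>)) {i, j}"
      by (rule indep_vars_compose2[OF indep_vars_subset[OF indep]]) (use i j in \<open>auto simp: Y_def\<close>)
    moreover have "integrable M (\<lambda>\<omega>. Y k (W k \<omega>))" if "k \<in> {i, j}" for k
      using that integrable_W i j by (auto simp: Y_def)
    ultimately have *: "integrable M (\<lambda>\<omega>. \<Prod>k\<in>{i, j}. Y k (W k \<omega>))"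
      "expectation (\<lambda>\<omega>. \<Prod>k\<in>{i, j}. Y k (W k \<omega>)) = (\<Prod>k\<in>{i, j}. expectation (\<lambda>\<omega>. Y k (W k \<omega>)))"
      by (auto intro!: indep_vars_integrable indep_vars_lebesgue_integral)
    thus ?thesis using False mean[OF j] by (simp add: Y_def)
  qed
  thus "integrable M (\<lambda>\<omega>. cnj (W i \<omega>) * W j \<omega>)"
    "expectation (\<lambda>\<omega>. cnj (W i \<omega>) * W j \<omega>) = (if i = j then 1 else 0)" by auto
qed

text \<open>Expand into constant, linear and quadratic parts: the linear ones vanish with the mean,
  and only the diagonal of the double sum survives.\<close>

lemma affine_row_products:
  assumes r: "r < n"
  shows "integrable M (\<lambda>\<omega>. cnj (a + (\<Sum>k<m. u k * W (r, k) \<omega>)) * (b + (\<Sum>k<m. v k * W (r, k) \<omega>)))"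
    and "expectation (\<lambda>\<omega>. cnj (a + (\<Sum>k<m. u k * W (r, k) \<omega>)) * (b + (\<Sum>k<m. v k * W (r, k) \<omega>))) =
      cnj a * b + (\<Sum>k<m. cnj (u k) * v k)"
proof -
  have eq: "cnj (a + (\<Sum>k<m. u k * W (r, k) \<omega>)) * (b + (\<Sum>k<m. v k * W (r, k) \<omega>)) =
    cnj a * b + (\<Sum>k<m. cnj a * v k * W (r, k) \<omega>) + (\<Sum>k<m. b * cnj (u k) * cnj (W (r, k) \<omega>)) +
    (\<Sum>k<m. \<Sum>l<m. cnj (u k) * v l * (cnj (W (r, k) \<omega>) * W (r, l) \<omega>))" for \<omega>
    by (simp add: distrib_left distrib_right sum_product sum_distrib_left mult_ac)
  have W: "has_bochner_integral M (W (r, k)) 0" if "k < m" for k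
    using integrable_W[of "(r, k)"] mean[of "(r, k)"] r that by (simp add: has_bochner_integral_iff)
  have WW: "has_bochner_integral M (\<lambda>\<omega>. cnj (W (r, k) \<omega>) * W (r, l) \<omega>) (if k = l then 1 else 0)"
    if "k < m" "l < m" for k l
    using W_products[of "(r, k)" "(r, l)"] r that by (simp add: has_bochner_integral_iff)
  have c: "has_bochner_integral M (\<lambda>_. c) c" for c :: complex
    by (simp add: has_bochner_integral_iff prob_space)
  have "has_bochner_integral M
    (\<lambda>\<omega>. cnj (a + (\<Sum>k<m. u k * W (r, k) \<omega>)) * (b + (\<Sum>k<m. v k * W (r, k) \<omega>)))
    (cnj a * b + (\<Sum>k<m. cnj a * v k * 0) + (\<Sum>k<m. b * cnj (u k) * cnj 0) +
      (\<Sum>k<m. \<Sum>l<m. cnj (u k) * v l * (if k = l then 1 else 0)))"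
    unfolding eq
    by (intro has_bochner_integral_add has_bochner_integral_sum has_bochner_integral_mult_right
        has_bochner_integral_cnj c W WW) auto
  also have "(\<Sum>k<m. \<Sum>l<m. cnj (u k) * v l * (if k = l then 1 else 0)) = (\<Sum>k<m. cnj (u k) * v k)"
    by (simp add: if_distrib cong: if_cong)
  finally show "integrable M (\<lambda>\<omega>. cnj (a + (\<Sum>k<m. u k * W (r, k) \<omega>)) * (b + (\<Sum>k<m. v k * W (r, k) \<omega>)))"
    and "expectation (\<lambda>\<omega>. cnj (a + (\<Sum>k<m. u k * W (r, k) \<omega>)) * (b + (\<Sum>k<m. v k * W (r, k) \<omega>))) =
      cnj a * b + (\<Sum>k<m. cnj (u k) * v k)"
    by (simp_all add: has_bochner_integral_iff)
qed

text \<open>Since \<open>f\<close> is injective, the factor of column \<open>j\<close> depends on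
  row \<open>f j\<close> alone and different columns use different rows. The factors are therefore
  independent and the expectation splits.\<close>

lemma expectation_prod_distinct_rows:
  fixes g A :: "nat \<Rightarrow> 'i \<Rightarrow> complex"
  assumes fin: "finite Q" and f: "f \<in> injE Q {..<n}"
  defines "X \<equiv> \<lambda>r j \<omega>. g r j + (\<Sum>k<m. A k j * W (r, k) \<omega>)"
  shows "integrable M (\<lambda>\<omega>. \<Prod>j\<in>Q. cnj (X (f j) (p j) \<omega>) * X (f j) j \<omega>)"
    and "expectation (\<lambda>\<omega>. \<Prod>j\<in>Q. cnj (X (f j) (p j) \<omega>) * X (f j) j \<omega>) =
      (\<Prod>j\<in>Q. cnj (g (f j) (p j)) * g (f j) j + (\<Sum>k<m. cnj (A k (p j)) * A k j))"
proof -
  have f': "f j < n" if "j \<in> Q" for j using f that by (auto simp: injE_def)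
  let ?K = "\<lambda>j. {f j} \<times> {..<m}"
  \<comment> \<open>Writes each factor as a measurable function of its own block of entries.\<close>
  define Y where "Y j v = cnj (g (f j) (p j) + (\<Sum>k<m. A k (p j) * v (f j, k))) *
    (g (f j) j + (\<Sum>k<m. A k j * v (f j, k)))" for j and v :: "nat \<times> nat \<Rightarrow> complex"
  have "indep_vars (\<lambda>j. PiM (?K j) (\<lambda>_. borel)) (\<lambda>j \<omega>. restrict (\<lambda>i. W i \<omega>) (?K j)) Q"
    by (rule indep_vars_restrict[OF indep])
       (use f' f in \<open>auto simp: disjoint_family_on_def injE_def inj_on_def\<close>)
  hence "indep_vars (\<lambda>_. borel) (\<lambda>j \<omega>. Y j (restrict (\<lambda>i. W i \<omega>) (?K j))) Q"
    by (rule indep_vars_compose2) (auto simp: Y_def intro!: borel_measurable_times borel_measurable_add borel_measurable_sum measurable_component_singleton measurable_compose[OF _ measurable_cnj])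
  moreover have "(\<lambda>j \<omega>. Y j (restrict (\<lambda>i. W i \<omega>) (?K j))) = (\<lambda>j \<omega>. cnj (X (f j) (p j) \<omega>) * X (f j) j \<omega>)"
    by (intro ext) (simp add: Y_def X_def)
  ultimately have ind: "indep_vars (\<lambda>_. borel) (\<lambda>j \<omega>. cnj (X (f j) (p j) \<omega>) * X (f j) j \<omega>) Q" by simp
  have int: "integrable M (\<lambda>\<omega>. cnj (X (f j) (p j) \<omega>) * X (f j) j \<omega>)" if "j \<in> Q" for j
    unfolding X_def by (rule affine_row_products(1)[OF f'[OF that]])
  show "integrable M (\<lambda>\<omega>. \<Prod>j\<in>Q. cnj (X (f j) (p j) \<omega>) * X (f j) j \<omega>)"
    by (rule indep_vars_integrable[OF fin ind int])
  have "expectation (\<lambda>\<omega>. \<Prod>j\<in>Q. cnj (X (f j) (p j) \<omega>) * X (f j) j \<omega>) =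
    (\<Prod>j\<in>Q. expectation (\<lambda>\<omega>. cnj (X (f j) (p j) \<omega>) * X (f j) j \<omega>))"
    by (rule indep_vars_lebesgue_integral[OF fin ind int])
  also have "\<dots> = (\<Prod>j\<in>Q. cnj (g (f j) (p j)) * g (f j) j + (\<Sum>k<m. cnj (A k (p j)) * A k j))"
    unfolding X_def by (intro prod.cong refl affine_row_products(2) f')
  finally show "expectation (\<lambda>\<omega>. \<Prod>j\<in>Q. cnj (X (f j) (p j) \<omega>) * X (f j) j \<omega>) =
      (\<Prod>j\<in>Q. cnj (g (f j) (p j)) * g (f j) j + (\<Sum>k<m. cnj (A k (p j)) * A k j))" .
qed

text \<open>\<open>pdet_gram\<close> leaves only terms in which no row occurs twice, so second
  moments suffice to evaluate the expectation.\<close>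

lemma expectation_pdet_gram:
  fixes g A :: "nat \<Rightarrow> 'i \<Rightarrow> complex"
  assumes fin: "finite Q"
  defines "X \<equiv> \<lambda>r j \<omega>. g r j + (\<Sum>k<m. A k j * W (r, k) \<omega>)"
  shows "integrable M (\<lambda>\<omega>. pdet Q (\<lambda>i j. \<Sum>r<n. cnj (X r i \<omega>) * X r j \<omega>))"
    and "expectation (\<lambda>\<omega>. pdet Q (\<lambda>i j. \<Sum>r<n. cnj (X r i \<omega>) * X r j \<omega>)) =
      (\<Sum>f\<in>injE Q {..<n}. pdet Q (\<lambda>i j. (\<Sum>k<m. cnj (A k i) * A k j) + cnj (g (f j) i) * g (f j) j))"
proof -
  have E: "integrable M (\<lambda>\<omega>. \<Prod>j\<in>Q. cnj (X (f j) (p j) \<omega>) * X (f j) j \<omega>)"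
    "expectation (\<lambda>\<omega>. \<Prod>j\<in>Q. cnj (X (f j) (p j) \<omega>) * X (f j) j \<omega>) =
      (\<Prod>j\<in>Q. cnj (g (f j) (p j)) * g (f j) j + (\<Sum>k<m. cnj (A k (p j)) * A k j))"
    if "f \<in> injE Q {..<n}" for f p
    unfolding X_def using that by (rule expectation_prod_distinct_rows[OF fin])+
  have eq: "pdet Q (\<lambda>i j. \<Sum>r<n. cnj (X r i \<omega>) * X r j \<omega>) =
     (\<Sum>f\<in>injE Q {..<n}. \<Sum>p | p permutes Q. of_int (sign p) * (\<Prod>j\<in>Q. cnj (X (f j) (p j) \<omega>) * X (f j) j \<omega>))" for \<omega>
    by (subst pdet_gram[OF fin]) (simp_all add: pdet_def)
  have int: "integrable M (\<lambda>\<omega>. of_int (sign p) * (\<Prod>j\<in>Q. cnj (X (f j) (p j) \<omega>) * X (f j) j \<omega>))"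
    if "f \<in> injE Q {..<n}" for f p
    using E(1)[OF that] by (rule integrable_mult_right)
  show "integrable M (\<lambda>\<omega>. pdet Q (\<lambda>i j. \<Sum>r<n. cnj (X r i \<omega>) * X r j \<omega>))"
    unfolding eq by (intro Bochner_Integration.integrable_sum int)
  have "expectation (\<lambda>\<omega>. pdet Q (\<lambda>i j. \<Sum>r<n. cnj (X r i \<omega>) * X r j \<omega>)) =
    (\<Sum>f\<in>injE Q {..<n}. \<Sum>p | p permutes Q.
      expectation (\<lambda>\<omega>. of_int (sign p) * (\<Prod>j\<in>Q. cnj (X (f j) (p j) \<omega>) * X (f j) j \<omega>)))"
    unfolding eq
    by (subst Bochner_Integration.integral_sum, intro Bochner_Integration.integrable_sum int, assumption,
        intro sum.cong refl, subst Bochner_Integration.integral_sum, intro int, assumption, rule refl)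
  also have "\<dots> = (\<Sum>f\<in>injE Q {..<n}. pdet Q (\<lambda>i j. (\<Sum>k<m. cnj (A k i) * A k j) + cnj (g (f j) i) * g (f j) j))"
    unfolding pdet_def by (intro sum.cong refl) (simp only: integral_mult_right_zero E(2) add.commute)
  finally show "expectation (\<lambda>\<omega>. pdet Q (\<lambda>i j. \<Sum>r<n. cnj (X r i \<omega>) * X r j \<omega>)) =
      (\<Sum>f\<in>injE Q {..<n}. pdet Q (\<lambda>i j. (\<Sum>k<m. cnj (A k i) * A k j) + cnj (g (f j) i) * g (f j) j))" .
qed

end

subsection \<open>The capacity bound\<close>

lemma mat_adjoint_index:
  fixes A :: "complex mat"
  assumes "i < dim_col A" "j < dim_row A"
  shows "mat_adjoint A $$ (i, j) = cnj (A $$ (j, i))"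
  using assms by (simp add: mat_adjoint_def mat_of_rows_def)

lemma mat_adjoint_carrier:
  "A \<in> carrier_mat n m \<Longrightarrow> mat_adjoint A \<in> carrier_mat m n"
  by (auto simp: mat_adjoint_def)

lemma mat_adjoint_mult_index:
  fixes A :: "complex mat"
  assumes "A \<in> carrier_mat n m" "i < m" "j < m"
  shows "(mat_adjoint A * A) $$ (i, j) = (\<Sum>r<n. cnj (A $$ (r, i)) * A $$ (r, j))"
proof -
  have "(mat_adjoint A * A) $$ (i, j) = (\<Sum>r\<in>{0..<n}. mat_adjoint A $$ (i, r) * A $$ (r, j))"
    using assms mat_adjoint_carrier[OF assms(1)] by (simp add: scalar_prod_def)
  also have "\<dots> = (\<Sum>r\<in>{0..<n}. cnj (A $$ (r, i)) * A $$ (r, j))"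
    using assms by (intro sum.cong refl) (simp add: mat_adjoint_index)
  finally show ?thesis by (simp add: atLeast0LessThan)
qed

text \<open>In the expansion into principal minors every term is nonnegative, and the empty set
  contributes \<open>d ^ card Q\<close>. It keeps the argument of the logarithm at least 1 and the
  minors of \<open>Psi\<close> away from 0.\<close>

lemma Re_pdet_scalar_add_gram_ge:
  fixes g :: "'b \<Rightarrow> 'i \<Rightarrow> complex"
  assumes fin: "finite Q" "finite N" and d: "d \<ge> 0" and c: "c \<ge> 0"
  shows "Re (pdet Q (\<lambda>i j. (if i = j then complex_of_real d else 0) +
    complex_of_real c * (\<Sum>r\<in>N. cnj (g r i) * g r j))) \<ge> d ^ card Q"
proof -
  let ?\<Gamma> = "\<lambda>i j. \<Sum>r\<in>N. cnj (g r i) * g r j"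
  let ?F = "\<lambda>K. of_real d ^ card (Q - K) * of_real c ^ card K * pdet K ?\<Gamma>"
  have pos: "0 \<le> Re (?F K)" if "K \<in> Pow Q" for K
  proof -
    have "finite K" using that fin finite_subset by auto
    hence "pdet K ?\<Gamma> \<in> \<real>\<^sub>\<ge>\<^sub>0" using fin by (intro nonneg_Reals_pdet_gram)
    then obtain x where "pdet K ?\<Gamma> = of_real x" "x \<ge> 0" by (auto elim: nonneg_Reals_cases)
    thus ?thesis using c d by (simp flip: of_real_power of_real_mult)
  qed
  have "d ^ card Q = Re (?F {})"
    by (simp add: pdet_def flip: of_real_power)
  also have "\<dots> \<le> (\<Sum>K\<in>Pow Q. Re (?F K))"
    using fin pos by (intro member_le_sum) auto
  also have "\<dots> = Re (pdet Q (\<lambda>i j. (if i = j then complex_of_real d else 0) + complex_of_real c * ?\<Gamma> i j))"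
    by (subst pdet_scalar_add[OF fin(1)]) simp
  finally show ?thesis .
qed

text \<open>Sylvester's identity passes to \<open>mat_adjoint A * A\<close>, whose entries are sums
  over the rows of \<open>A\<close>, the independent units of the model.\<close>

lemma det_one_add_gram:
  assumes A: "A \<in> carrier_mat n m"
  shows "Determinant.det (1\<^sub>m n + c \<cdot>\<^sub>m (A * mat_adjoint A)) =
    pdet {..<m} (\<lambda>i j. (if i = j then 1 else 0) + c * (\<Sum>r<n. cnj (A $$ (r, i)) * A $$ (r, j)))"
proof -
  have A': "mat_adjoint A \<in> carrier_mat m n" by (rule mat_adjoint_carrier[OF A])
  have "1\<^sub>m n + c \<cdot>\<^sub>m (A * mat_adjoint A) = 1\<^sub>m n + (c \<cdot>\<^sub>m A) * mat_adjoint A"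
    using mult_smult_assoc_mat[OF A A'] by simp
  also have "Determinant.det \<dots> = Determinant.det (1\<^sub>m m + mat_adjoint A * (c \<cdot>\<^sub>m A))"
    using A A' by (intro det_one_add_mult_commute) auto
  also have "mat_adjoint A * (c \<cdot>\<^sub>m A) = c \<cdot>\<^sub>m (mat_adjoint A * A)"
    by (rule mult_smult_distrib[OF A' A])
  also have "Determinant.det (1\<^sub>m m + c \<cdot>\<^sub>m (mat_adjoint A * A)) =
    pdet {..<m} (\<lambda>i j. (if i = j then 1 else 0) + c * (mat_adjoint A * A) $$ (i, j))"
  proof -
    define B where "B = mat_adjoint A * A"
    have "B \<in> carrier_mat m m" using A A' by (auto simp: B_def)
    thus ?thesis unfolding B_def[symmetric]
      by (subst det_eq_pdet[of _ m]) (auto intro!: pdet_cong)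
  qed
  also have "\<dots> = pdet {..<m} (\<lambda>i j. (if i = j then 1 else 0) + c * (\<Sum>r<n. cnj (A $$ (r, i)) * A $$ (r, j)))"
    by (intro pdet_cong) (simp only: mat_adjoint_mult_index[OF A] lessThan_iff)
  finally show ?thesis .
qed

text \<open>Jensen's inequality, from the tangent of the logarithm at the mean.\<close>

lemma (in prob_space) expectation_log_le:
  assumes X: "integrable M X" and ge: "\<And>\<omega>. \<omega> \<in> space M \<Longrightarrow> X \<omega> \<ge> 1"
  shows "expectation (\<lambda>\<omega>. log 2 (X \<omega>)) \<le> log 2 (expectation X)"
proof (cases "integrable M (\<lambda>\<omega>. log 2 (X \<omega>))")
  case int: True
  let ?\<mu> = "expectation X"
  have mu: "?\<mu> \<ge> 1"
    using integral_mono[of M "\<lambda>_. 1" X] X ge by (simp add: prob_space)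
  have "expectation (\<lambda>\<omega>. log 2 (X \<omega>)) \<le> expectation (\<lambda>\<omega>. log 2 ?\<mu> + (X \<omega> - ?\<mu>) / (?\<mu> * ln 2))"
  proof (rule integral_mono[OF int])
    show "integrable M (\<lambda>\<omega>. log 2 ?\<mu> + (X \<omega> - ?\<mu>) / (?\<mu> * ln 2))" using X by simp
    fix \<omega> assume "\<omega> \<in> space M"
    hence "X \<omega> > 0" using ge by fastforce
    hence "ln (X \<omega> / ?\<mu>) \<le> X \<omega> / ?\<mu> - 1" using mu by (intro ln_le_minus_one) simp
    hence "ln (X \<omega>) \<le> ln ?\<mu> + (X \<omega> - ?\<mu>) / ?\<mu>"
      using \<open>X \<omega> > 0\<close> mu by (simp add: ln_div diff_divide_distrib)
    hence "ln (X \<omega>) / ln 2 \<le> (ln ?\<mu> + (X \<omega> - ?\<mu>) / ?\<mu>) / ln 2"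
      by (intro divide_right_mono) auto
    thus "log 2 (X \<omega>) \<le> log 2 ?\<mu> + (X \<omega> - ?\<mu>) / (?\<mu> * ln 2)"
      by (simp add: log_def add_divide_distrib)
  qed
  also have "\<dots> = log 2 ?\<mu>" using X by (simp add: prob_space)
  finally show ?thesis .
next
  case False
  \<comment> \<open>A non-integrable function has integral 0 by convention, so it is enough that the
    right-hand side is nonnegative.\<close>
  have "expectation X \<ge> 1"
    using integral_mono[of M "\<lambda>_. 1" X] X ge by (simp add: prob_space)
  thus ?thesis using False by (simp add: not_integrable_integral_eq)
qed

text \<open>The bound for any matrix whose rows are affine images of the rows of \<open>W\<close>
  with common coefficients \<open>A\<close>; \<open>Psi\<close> is the shared second-moment matrix
  of the centred rows and \<open>Gb\<close> the mean.\<close>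

lemma (in white_matrix) expectation_log_det_le:
  fixes G :: "'a \<Rightarrow> complex mat" and Gb Psi Sigma :: "complex mat" and A :: "nat \<Rightarrow> nat \<Rightarrow> complex"
  assumes rho: "rho \<ge> 0"
    and G: "\<And>\<omega>. G \<omega> \<in> carrier_mat n N"
    and G_index: "\<And>\<omega> r j. r < n \<Longrightarrow> j < N \<Longrightarrow> G \<omega> $$ (r, j) = Gb $$ (r, j) + (\<Sum>k<m. A k j * W (r, k) \<omega>)"
    and Gb: "Gb \<in> carrier_mat n N" and Psi: "Psi \<in> carrier_mat N N"
    and Psi_index: "\<And>i j. i < N \<Longrightarrow> j < N \<Longrightarrow> Psi $$ (i, j) = (\<Sum>k<m. cnj (A k i) * A k j)"
    and det: "\<And>Q. Q \<subseteq> {..<N} \<Longrightarrow> Determinant.det (principal Psi Q) \<noteq> 0"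
  defines "Sigma \<equiv> mat_adjoint Gb * Gb"
  defines "E \<equiv> \<lambda>Q. nonzero_eigs (the (mat_inverse (principal Psi Q)) * principal Sigma Q)"
  shows "expectation (\<lambda>\<omega>. log 2 (Re (Determinant.det (1\<^sub>m n + complex_of_real rho \<cdot>\<^sub>m (G \<omega> * mat_adjoint (G \<omega>))))))
    \<le> log 2 (Re (\<Sum>t\<in>{0..n}. complex_of_real (rho ^ t) *
         (\<Sum>Q\<in>{Q. Q \<subseteq> {..<N} \<and> card Q = t}. Determinant.det (principal Psi Q) * J_mset (int n) (E Q)
            * complex_of_real (fact (n - size (E Q)) / fact (n - t)))))"
proof -
  define X where "X r j \<omega> = Gb $$ (r, j) + (\<Sum>k<m. A k j * W (r, k) \<omega>)" for r j \<omega>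
  define D where "D \<omega> = Determinant.det (1\<^sub>m n + complex_of_real rho \<cdot>\<^sub>m (G \<omega> * mat_adjoint (G \<omega>)))" for \<omega>
  let ?\<Gamma> = "\<lambda>\<omega> i j. \<Sum>r<n. cnj (X r i \<omega>) * X r j \<omega>"
  let ?T = "\<lambda>Q. Determinant.det (principal Psi Q) * J_mset (int n) (E Q)
            * complex_of_real (fact (n - size (E Q)) / fact (n - card Q))"
  have Sigma: "Sigma \<in> carrier_mat N N"
    unfolding Sigma_def using Gb mat_adjoint_carrier[OF Gb] by auto
  have D: "D \<omega> = pdet {..<N} (\<lambda>i j. (if i = j then 1 else 0) + complex_of_real rho * ?\<Gamma> \<omega> i j)" for \<omega>
    unfolding D_def det_one_add_gram[OF G] by (intro pdet_cong) (simp add: G_index X_def)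
  have D_sum: "D \<omega> = (\<Sum>Q\<in>Pow {..<N}. complex_of_real (rho ^ card Q) * pdet Q (?\<Gamma> \<omega>))" for \<omega>
    unfolding D by (subst pdet_scalar_add) simp_all
  have int: "integrable M (\<lambda>\<omega>. pdet Q (?\<Gamma> \<omega>))" if "Q \<in> Pow {..<N}" for Q
    unfolding X_def using that finite_subset by (intro expectation_pdet_gram(1)) auto
  have intD: "integrable M D"
    unfolding D_sum by (intro Bochner_Integration.integrable_sum integrable_mult_right int)
  \<comment> \<open>For \<open>card Q > n\<close> no injective assignment exists; otherwise the
    counting lemma and the pencil identity meet in the mixed determinants of \<open>Sigma\<close>
    and \<open>Psi\<close>.\<close>
  have exp_pdet: "expectation (\<lambda>\<omega>. pdet Q (?\<Gamma> \<omega>)) = (if card Q \<le> n then ?T Q else 0)" if "Q \<in> Pow {..<N}" for Q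
  proof -
    have Q: "Q \<subseteq> {..<N}" "finite Q" using that finite_subset by auto
    have "expectation (\<lambda>\<omega>. pdet Q (?\<Gamma> \<omega>)) = (\<Sum>f\<in>injE Q {..<n}. pdet Q (\<lambda>i j. (\<Sum>k<m. cnj (A k i) * A k j) +
        cnj (Gb $$ (f j, i)) * Gb $$ (f j, j)))"
      unfolding X_def by (rule expectation_pdet_gram(2)[OF Q(2)])
    also have "\<dots> = (if card Q \<le> n then ?T Q else 0)"
    proof (cases "card Q \<le> n")
      case True
      have "(\<Sum>f\<in>injE Q {..<n}. pdet Q (\<lambda>i j. (\<Sum>k<m. cnj (A k i) * A k j) +
        cnj (Gb $$ (f j, i)) * Gb $$ (f j, j))) =
        (\<Sum>K\<in>Pow Q. fact (n - card K) / fact (n - card Q) *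
          pdet Q (\<lambda>i j. if j \<in> K then (\<Sum>r<n. cnj (Gb $$ (r, i)) * Gb $$ (r, j)) else (\<Sum>k<m. cnj (A k i) * A k j)))"
        using sum_injE_pdet_rank_one_update[OF Q(2), of "{..<n}" "\<lambda>i j. \<Sum>k<m. cnj (A k i) * A k j"
          "\<lambda>r i. cnj (Gb $$ (r, i))" "\<lambda>r j. Gb $$ (r, j)"] True by simp
      also have "\<dots> = (\<Sum>K\<in>Pow Q. fact (n - card K) / fact (n - card Q) *
          pdet Q (\<lambda>i j. if j \<in> K then Sigma $$ (i, j) else Psi $$ (i, j)))"
      proof (intro sum.cong refl arg_cong2[of _ _ _ _ "(*)"] pdet_cong)
        fix K i j assume "i \<in> Q" "j \<in> Q"
        hence "i < N" "j < N" using Q by auto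
        thus "(if j \<in> K then (\<Sum>r<n. cnj (Gb $$ (r, i)) * Gb $$ (r, j)) else (\<Sum>k<m. cnj (A k i) * A k j)) =
          (if j \<in> K then Sigma $$ (i, j) else Psi $$ (i, j))"
          unfolding Sigma_def by (simp only: mat_adjoint_mult_index[OF Gb] Psi_index)
      qed
      also have "\<dots> = ?T Q"
        unfolding E_def by (rule det_mult_J_mset[OF Psi Sigma Q(1) det[OF Q(1)] True, symmetric])
      finally show ?thesis using True by simp
    next
      case False
      thus ?thesis using injE_empty_if_card_less[of "{..<n}" Q] by simp
    qed
    finally show ?thesis .
  qed
  have "expectation D = (\<Sum>Q\<in>Pow {..<N}. complex_of_real (rho ^ card Q) * (if card Q \<le> n then ?T Q else 0))"
    unfolding D_sum
    by (subst Bochner_Integration.integral_sum) (simp_all add: int exp_pdet)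
  also have "\<dots> = (\<Sum>Q\<in>{Q \<in> Pow {..<N}. card Q \<le> n}. complex_of_real (rho ^ card Q) * ?T Q)"
    by (rule sum.mono_neutral_cong_right) auto
  also have "\<dots> = (\<Sum>t\<in>{0..n}. \<Sum>Q\<in>{Q \<in> {Q \<in> Pow {..<N}. card Q \<le> n}. card Q = t}. complex_of_real (rho ^ card Q) * ?T Q)"
    by (rule sum.group[symmetric]) auto
  also have "\<dots> = (\<Sum>t\<in>{0..n}. complex_of_real (rho ^ t) *
         (\<Sum>Q\<in>{Q. Q \<subseteq> {..<N} \<and> card Q = t}. Determinant.det (principal Psi Q) * J_mset (int n) (E Q)
            * complex_of_real (fact (n - size (E Q)) / fact (n - t))))"
    unfolding sum_distrib_left by (intro sum.cong refl) auto
  finally have ED: "expectation D = \<dots>" .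
  \<comment> \<open>The empty minor contributes 1 and the others are nonnegative.\<close>
  have "Re (D \<omega>) \<ge> 1" for \<omega>
    using Re_pdet_scalar_add_gram_ge[of "{..<N}" "{..<n}" 1 rho "\<lambda>r i. X r i \<omega>"] rho
    unfolding D of_real_1 by simp
  moreover have "integrable M (\<lambda>\<omega>. Re (D \<omega>))" using intD by simp
  ultimately have "expectation (\<lambda>\<omega>. log 2 (Re (D \<omega>))) \<le> log 2 (expectation (\<lambda>\<omega>. Re (D \<omega>)))"
    by (intro expectation_log_le) auto
  also have "expectation (\<lambda>\<omega>. Re (D \<omega>)) = Re (expectation D)" using intD by simp
  finally show ?thesis unfolding ED D_def .
qed

section \<open>The Gaussian pair as one white matrix\<close>

lemma prob_space_gauss_mat: "prob_space (gauss_mat n m)"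
  unfolding gauss_mat_def by (intro prob_space_PiM prob_space_CN_measure)

text \<open>Columns below \<open>M\<close> come from the first matrix, the others from the second.
  The joint law is identified on boxes as a product of \<open>CN_measure\<close>, which yields both
  the marginals and independence.\<close>

lemma white_matrix_gauss_mat_pair:
  assumes "n > 0" "M > 0"
  shows "white_matrix (gauss_mat n M \<Otimes>\<^sub>M gauss_mat n N)
    (\<lambda>(r, k) w. if k < M then fst w (r, k) else snd w (r, k - M)) n (M + N)"
proof -
  let ?P = "gauss_mat n M \<Otimes>\<^sub>M gauss_mat n N"
  let ?I = "{..<n} \<times> {..<M + N}" and ?I1 = "{..<n} \<times> {..<M}" and ?I2 = "{..<n} \<times> {..<N}"
  define W where "W = (\<lambda>(r, k) (w :: (nat \<times> nat \<Rightarrow> complex) \<times> (nat \<times> nat \<Rightarrow> complex)).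
    if k < M then fst w (r, k) else snd w (r, k - M))"
  interpret G1: prob_space "gauss_mat n M" by (rule prob_space_gauss_mat)
  interpret G2: prob_space "gauss_mat n N" by (rule prob_space_gauss_mat)
  interpret P: pair_prob_space "gauss_mat n M" "gauss_mat n N" ..
  interpret CN: prob_space CN_measure by (rule prob_space_CN_measure)
  interpret PS: product_sigma_finite "\<lambda>_ :: nat \<times> nat. CN_measure" ..
  have W_meas: "W i \<in> measurable ?P borel" if i_in: "i \<in> ?I" for i
  proof -
    obtain r k where i: "i = (r, k)" "r < n" "k < M + N" using i_in by auto
    show ?thesis
    proof (cases "k < M")
      case True
      have "(\<lambda>w. w (r, k)) \<in> measurable (gauss_mat n M) borel"
        unfolding gauss_mat_def using i True measurable_component_singleton[of "(r, k)" ?I1 "\<lambda>_. CN_measure"]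
        by (simp cong: measurable_cong_sets)
      from measurable_compose[OF measurable_fst this] show ?thesis using True i by (simp add: W_def)
    next
      case False
      have "(\<lambda>w. w (r, k - M)) \<in> measurable (gauss_mat n N) borel"
        unfolding gauss_mat_def using i False measurable_component_singleton[of "(r, k - M)" ?I2 "\<lambda>_. CN_measure"]
        by (simp cong: measurable_cong_sets)
      from measurable_compose[OF measurable_snd this] show ?thesis using False i by (simp add: W_def)
    qed
  qed
  let ?\<Phi> = "\<lambda>w. \<lambda>i\<in>?I. W i w"
  have \<Phi>_meas: "?\<Phi> \<in> measurable ?P (PiM ?I (\<lambda>_. borel))"
    by (intro measurable_restrict W_meas)
  have joint: "distr ?P (PiM ?I (\<lambda>_. borel)) ?\<Phi> = PiM ?I (\<lambda>_. CN_measure)"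
  proof (rule PS.PiM_eqI)
    show "sets (distr ?P (PiM ?I (\<lambda>_. borel)) ?\<Phi>) = sets (PiM ?I (\<lambda>_. CN_measure))"
      by (simp cong: sets_PiM_cong)
    fix A :: "nat \<times> nat \<Rightarrow> complex set" assume A: "\<And>i. i \<in> ?I \<Longrightarrow> A i \<in> sets CN_measure"
    \<comment> \<open>The sides of the box belonging to the second matrix, whose columns are
      displaced by \<open>M\<close>.\<close>
    let ?B = "\<lambda>(r, k). A (r, M + k)"
    have box: "?\<Phi> -` PiE ?I A \<inter> space ?P = PiE ?I1 A \<times> PiE ?I2 ?B"
    proof (intro Set.set_eqI iffI)
      fix w assume w: "w \<in> ?\<Phi> -` PiE ?I A \<inter> space ?P"
      have ext: "fst w \<in> extensional ?I1" "snd w \<in> extensional ?I2"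
        using w by (auto simp: space_pair_measure gauss_mat_def space_PiM PiE_def)
      have W: "W i w \<in> A i" if "i \<in> ?I" for i using w that by (auto dest: PiE_mem)
      have "fst w i \<in> A i" if "i \<in> ?I1" for i
        using that W[of i] by (cases i) (auto simp: W_def)
      moreover have "snd w i \<in> ?B i" if "i \<in> ?I2" for i
        using that W[of "(fst i, M + snd i)"] by (cases i) (auto simp: W_def)
      ultimately show "w \<in> PiE ?I1 A \<times> PiE ?I2 ?B"
        using ext by (cases w) (auto simp: PiE_def)
    next
      fix w assume w: "w \<in> PiE ?I1 A \<times> PiE ?I2 ?B"
      have "W i w \<in> A i" if i: "i \<in> ?I" for i
      proof -
        obtain r k where rk: "i = (r, k)" "r < n" "k < M + N" using i by auto
        show ?thesis
        proof (cases "k < M")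
          case True
          thus ?thesis using w rk by (auto simp: W_def)
        next
          case False
          hence "(r, k - M) \<in> ?I2" "M + (k - M) = k" using rk by auto
          thus ?thesis using w rk False PiE_mem[of "snd w" ?I2 ?B "(r, k - M)"] by (auto simp: W_def)
        qed
      qed
      moreover have "w \<in> space ?P"
        using w by (auto simp: space_pair_measure gauss_mat_def space_PiM PiE_def)
      ultimately show "w \<in> ?\<Phi> -` PiE ?I A \<inter> space ?P" by auto
    qed
    have setsA: "PiE ?I A \<in> sets (PiM ?I (\<lambda>_. borel))"
      using A by (intro sets_PiM_I_finite) auto
    have s1: "PiE ?I1 A \<in> sets (gauss_mat n M)" and s2: "PiE ?I2 ?B \<in> sets (gauss_mat n N)"
      unfolding gauss_mat_def using A by (auto intro!: sets_PiM_I_finite)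
    have "emeasure (distr ?P (PiM ?I (\<lambda>_. borel)) ?\<Phi>) (PiE ?I A) =
      emeasure (gauss_mat n M) (PiE ?I1 A) * emeasure (gauss_mat n N) (PiE ?I2 ?B)"
      unfolding emeasure_distr[OF \<Phi>_meas setsA] box by (rule G2.emeasure_pair_measure_Times[OF s1 s2])
    also have "emeasure (gauss_mat n M) (PiE ?I1 A) = (\<Prod>i\<in>?I1. emeasure CN_measure (A i))"
      unfolding gauss_mat_def using A by (intro PS.emeasure_PiM) auto
    also have "emeasure (gauss_mat n N) (PiE ?I2 ?B) = (\<Prod>i\<in>?I2. emeasure CN_measure (?B i))"
      unfolding gauss_mat_def using A by (intro PS.emeasure_PiM) auto
    also have "\<dots> = (\<Prod>i\<in>{..<n} \<times> {M..<M + N}. emeasure CN_measure (A i))"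
      by (rule prod.reindex_bij_witness[where i = "\<lambda>(r, k). (r, k - M)" and j = "\<lambda>(r, k). (r, M + k)"]) auto
    also have "(\<Prod>i\<in>?I1. emeasure CN_measure (A i)) * \<dots> =
      (\<Prod>i\<in>?I1 \<union> {..<n} \<times> {M..<M + N}. emeasure CN_measure (A i))"
      by (rule prod.union_disjoint[symmetric]) auto
    also have "?I1 \<union> {..<n} \<times> {M..<M + N} = ?I" by auto
    finally show "emeasure (distr ?P (PiM ?I (\<lambda>_. borel)) ?\<Phi>) (PiE ?I A) = (\<Prod>i\<in>?I. emeasure CN_measure (A i))" .
  qed simp
  have marginal: "distr ?P borel (W i) = CN_measure" if i: "i \<in> ?I" for i
  proof -
    have "distr ?P borel (W i) = distr (distr ?P (PiM ?I (\<lambda>_. borel)) ?\<Phi>) borel (\<lambda>v. v i)"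
      using i by (subst distr_distr[OF _ \<Phi>_meas]) (auto simp: o_def intro!: distr_cong measurable_component_singleton)
    also have "\<dots> = distr (PiM ?I (\<lambda>_. CN_measure)) CN_measure (\<lambda>v. v i)"
      unfolding joint by (rule distr_cong) auto
    also have "\<dots> = CN_measure"
      using i by (intro distr_PiM_component prob_space_CN_measure) auto
    finally show ?thesis .
  qed
  have "white_matrix ?P W n (M + N)"
  proof (unfold_locales)
    \<comment> \<open>Independence is characterised by the joint law being the product of the
      marginals over a nonempty index set.\<close>
    have "?I \<noteq> {}" using assms by auto
    hence "P.indep_vars (\<lambda>_. borel) W ?I \<longleftrightarrow>
      distr ?P (PiM ?I (\<lambda>_. borel)) ?\<Phi> = PiM ?I (\<lambda>i. distr ?P borel (W i))"
      by (intro P.indep_vars_iff_distr_eq_PiM' W_meas)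
    also have "PiM ?I (\<lambda>i. distr ?P borel (W i)) = PiM ?I (\<lambda>_. CN_measure)"
      by (intro PiM_cong refl marginal)
    finally show "P.indep_vars (\<lambda>_. borel) W ?I" using joint by blast
    fix i assume i: "i \<in> ?I"
    show "integrable ?P (\<lambda>\<omega>. (cmod (W i \<omega>))\<^sup>2)"
      using integrable_CN_measure_square unfolding marginal[OF i, symmetric]
      by (subst (asm) integrable_distr_eq) (auto intro: W_meas i)
    show "P.expectation (W i) = 0"
      using integral_CN_measure_mean unfolding marginal[OF i, symmetric]
      by (subst (asm) integral_distr) (auto intro: W_meas i)
    show "P.expectation (\<lambda>\<omega>. (cmod (W i \<omega>))\<^sup>2) = 1"
      using integral_CN_measure_square unfolding marginal[OF i, symmetric]
      by (subst (asm) integral_distr) (auto intro: W_meas i)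
  qed
  thus ?thesis unfolding W_def .
qed

section \<open>The line-of-sight channel\<close>

lemma sum_lessThan_add:
  fixes f :: "nat \<Rightarrow> 'a :: comm_monoid_add"
  shows "(\<Sum>k<m + n. f k) = (\<Sum>k<m. f k) + (\<Sum>k<n. f (m + k))"
  by (induction n) (simp_all add: add.assoc)

lemma mult_mat_diag_mult_index:
  fixes A B :: "'a :: comm_ring_1 mat"
  assumes "A \<in> carrier_mat n m" "B \<in> carrier_mat m l" "r < n" "j < l"
  shows "(A * mat_diag m f * B) $$ (r, j) = (\<Sum>k<m. A $$ (r, k) * f k * B $$ (k, j))"
  using assms unfolding mat_diag_mult_right[OF assms(1)]
  by (simp add: scalar_prod_def atLeast0LessThan)

theorem theorem2:
  fixes Nt Nr Mh Mv M PT PR PH :: nat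
    and dt dr dh dv lam :: real
    and tg rg hg :: "nat \<Rightarrow> complex"
    and phia1 tha1 thd1 tha2 phid2 thd2 tha3 thd3 :: "nat \<Rightarrow> real"
    and phase :: "nat \<Rightarrow> real"
    and bt br bd LR NR LH NH rho rhob :: real
    and Tm Rbar Hbar Phi Gbar Psi Sigma :: "complex mat"
    and G :: "(nat \<times> nat \<Rightarrow> complex) \<Rightarrow> (nat \<times> nat \<Rightarrow> complex) \<Rightarrow> complex mat"
  assumes "Nt > 0" and "Nr > 0" and "Mh > 0" and "Mv > 0"
    and "PT > 0" and "PR > 0" and "PH > 0"
    and "lam > 0"
    and "Nt > Nr"
    and "bt > 0" and "br > 0" and "bd > 0"
    and "LR \<ge> 0" and "NR \<ge> 0" and "LR + NR = 1"
    and "LH \<ge> 0" and "NH > 0" and "LH + NH = 1"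
    and "rho > 0"
  defines "M \<equiv> Mh * Mv"
    and "Tm \<equiv> los_mat M Nt PT tg (\<lambda>i. steer2 Mh Mv dh dv lam (phia1 i) (tha1 i))
                                  (\<lambda>i. steer Nt dt lam (thd1 i))"
    and "Rbar \<equiv> los_mat Nr M PR rg (\<lambda>i. steer Nr dr lam (tha2 i))
                                  (\<lambda>i. steer2 Mh Mv dh dv lam (phid2 i) (thd2 i))"
    and "Hbar \<equiv> los_mat Nr Nt PH hg (\<lambda>i. steer Nr dr lam (tha3 i))
                                  (\<lambda>i. steer Nt dt lam (thd3 i))"
    and "Phi \<equiv> mat_diag M (\<lambda>m. exp (\<i> * complex_of_real (phase m)))"
    and "G \<equiv> (\<lambda>fR fH.
            complex_of_real (sqrt (bt * br)) \<cdot>\<^sub>m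
              ((complex_of_real (sqrt LR) \<cdot>\<^sub>m Rbar + complex_of_real (sqrt NR) \<cdot>\<^sub>m to_mat Nr M fR)
               * Phi * Tm)
            + complex_of_real (sqrt bd) \<cdot>\<^sub>m
              (complex_of_real (sqrt LH) \<cdot>\<^sub>m Hbar + complex_of_real (sqrt NH) \<cdot>\<^sub>m to_mat Nr Nt fH))"
    and "Gbar \<equiv> complex_of_real (sqrt (bt * br * LR)) \<cdot>\<^sub>m (Rbar * Phi * Tm)
               + complex_of_real (sqrt (bd * LH)) \<cdot>\<^sub>m Hbar"
    and "Psi \<equiv> complex_of_real (bt * br * NR) \<cdot>\<^sub>m (mat_adjoint Tm * Tm)
              + complex_of_real (bd * NH) \<cdot>\<^sub>m 1\<^sub>m Nt"
    and "Sigma \<equiv> mat_adjoint Gbar * Gbar"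
    and "rhob \<equiv> rho / real Nt"
  shows "(\<integral>w. (case w of (fR, fH) \<Rightarrow>
             log 2 (Re (Determinant.det (1\<^sub>m Nr + complex_of_real rhob \<cdot>\<^sub>m (G fR fH * mat_adjoint (G fR fH))))))
           \<partial>(gauss_mat Nr M \<Otimes>\<^sub>M gauss_mat Nr Nt))
         \<le> log 2 (Re (\<Sum>t\<in>{0..Nr}. complex_of_real (rhob ^ t) *
               (\<Sum>Q\<in>{Q. Q \<subseteq> {..<Nt} \<and> card Q = t}.
                  Determinant.det (principal Psi Q)
                  * J_mset (int Nr) (nonzero_eigs (the (mat_inverse (principal Psi Q)) * principal Sigma Q))
                  * complex_of_real (fact (Nr - size (nonzero_eigs (the (mat_inverse (principal Psi Q)) * principal Sigma Q)))
                                     / fact (Nr - t)))))"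
proof -
  \<comment> \<open>Stacks \<open>Phi * Tm\<close>, scaled by \<open>sqrt (bt * br * NR)\<close>, on
    the identity scaled by \<open>sqrt (bd * NH)\<close>. A row of the two noise matrices side by
    side times \<open>A\<close> is then the random part of the same row of \<open>G\<close>, and the
    Gram matrix of \<open>A\<close> is \<open>Psi\<close>.\<close>
  define A where "A k j = (if k < M then complex_of_real (sqrt (bt * br * NR)) * cis (phase k) * Tm $$ (k, j)
    else complex_of_real (sqrt (bd * NH)) * (if k - M = j then 1 else 0))" for k j
  have Tm: "Tm \<in> carrier_mat M Nt" and Rbar: "Rbar \<in> carrier_mat Nr M" and Hbar: "Hbar \<in> carrier_mat Nr Nt"
    by (simp_all add: Tm_def Rbar_def Hbar_def los_mat_def)
  have Phi: "Phi = mat_diag M (\<lambda>k. cis (phase k))"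
    by (simp add: Phi_def cis_conv_exp)
  have Phi_carrier: "Phi \<in> carrier_mat M M" by (simp add: Phi)
  have TT: "mat_adjoint Tm * Tm \<in> carrier_mat Nt Nt"
    using Tm mat_adjoint_carrier[OF Tm] by auto
  have Gbar: "Gbar \<in> carrier_mat Nr Nt" and Psi: "Psi \<in> carrier_mat Nt Nt"
    using Rbar Phi_carrier Tm Hbar TT by (auto simp: Gbar_def Psi_def)
  have G: "G fR fH \<in> carrier_mat Nr Nt" for fR fH
    using Rbar Phi_carrier Tm Hbar by (auto simp: G_def to_mat_def)
  have Gbar_index: "Gbar $$ (r, j) = complex_of_real (sqrt (bt * br * LR)) *
      (\<Sum>k<M. Rbar $$ (r, k) * cis (phase k) * Tm $$ (k, j)) + complex_of_real (sqrt (bd * LH)) * Hbar $$ (r, j)"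
    if "r < Nr" "j < Nt" for r j
  proof -
    define B where "B = Rbar * Phi * Tm"
    have "B \<in> carrier_mat Nr Nt" using Rbar Phi_carrier Tm by (auto simp: B_def)
    moreover have "B $$ (r, j) = (\<Sum>k<M. Rbar $$ (r, k) * cis (phase k) * Tm $$ (k, j))"
      unfolding B_def Phi by (rule mult_mat_diag_mult_index[OF Rbar Tm that])
    ultimately show ?thesis
      unfolding Gbar_def B_def[symmetric] using that Hbar by simp
  qed
  have G_index: "G fR fH $$ (r, j) = Gbar $$ (r, j) +
      (\<Sum>k<M + Nt. A k j * (if k < M then fR (r, k) else fH (r, k - M)))"
    if rj: "r < Nr" "j < Nt" for fR fH r j
  proof -
    define R where "R = complex_of_real (sqrt LR) \<cdot>\<^sub>m Rbar + complex_of_real (sqrt NR) \<cdot>\<^sub>m to_mat Nr M fR"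
    have R: "R \<in> carrier_mat Nr M" using Rbar by (auto simp: R_def to_mat_def)
    have R_index: "R $$ (r, k) = complex_of_real (sqrt LR) * Rbar $$ (r, k) + complex_of_real (sqrt NR) * fR (r, k)"
      if "k < M" for k using that rj Rbar by (simp add: R_def to_mat_def)
    define B where "B = R * Phi * Tm"
    have B: "B \<in> carrier_mat Nr Nt" using R Phi_carrier Tm by (auto simp: B_def)
    have "G fR fH $$ (r, j) = complex_of_real (sqrt (bt * br)) * B $$ (r, j)
      + complex_of_real (sqrt bd) * (complex_of_real (sqrt LH) * Hbar $$ (r, j) + complex_of_real (sqrt NH) * fH (r, j))"
      unfolding G_def R_def[symmetric] B_def[symmetric] using rj Hbar B by (simp add: to_mat_def)
    also have "B $$ (r, j) = (\<Sum>k<M. R $$ (r, k) * cis (phase k) * Tm $$ (k, j))"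
      unfolding B_def Phi by (rule mult_mat_diag_mult_index[OF R Tm rj])
    also have "\<dots> = complex_of_real (sqrt LR) * (\<Sum>k<M. Rbar $$ (r, k) * cis (phase k) * Tm $$ (k, j)) +
      complex_of_real (sqrt NR) * (\<Sum>k<M. cis (phase k) * Tm $$ (k, j) * fR (r, k))"
      unfolding sum_distrib_left sum.distrib[symmetric]
      by (intro sum.cong refl) (simp add: R_index algebra_simps)
    finally have "G fR fH $$ (r, j) = Gbar $$ (r, j) +
      (\<Sum>k<M. complex_of_real (sqrt (bt * br * NR)) * cis (phase k) * Tm $$ (k, j) * fR (r, k)) +
      complex_of_real (sqrt (bd * NH)) * fH (r, j)"
      unfolding Gbar_index[OF rj]
      by (simp add: real_sqrt_mult algebra_simps sum_distrib_left)
    also have "(\<Sum>k<M. complex_of_real (sqrt (bt * br * NR)) * cis (phase k) * Tm $$ (k, j) * fR (r, k)) =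
      (\<Sum>k<M. A k j * (if k < M then fR (r, k) else fH (r, k - M)))"
      by (intro sum.cong refl) (simp add: A_def)
    also have "complex_of_real (sqrt (bd * NH)) * fH (r, j) =
      (\<Sum>k<Nt. A (M + k) j * (if M + k < M then fR (r, M + k) else fH (r, M + k - M)))"
      using rj by (simp add: A_def if_distrib[of "\<lambda>x. _ * x * _"] cong: if_cong)
    finally show ?thesis by (simp add: sum_lessThan_add add.assoc)
  qed
  have Psi_index': "Psi $$ (i, j) = (if i = j then complex_of_real (bd * NH) else 0) +
      complex_of_real (bt * br * NR) * (\<Sum>k<M. cnj (Tm $$ (k, i)) * Tm $$ (k, j))"
    if "i < Nt" "j < Nt" for i j
  proof -
    define B where "B = mat_adjoint Tm * Tm"
    have "B \<in> carrier_mat Nt Nt" "B $$ (i, j) = (\<Sum>k<M. cnj (Tm $$ (k, i)) * Tm $$ (k, j))"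
      using TT mat_adjoint_mult_index[OF Tm that] by (simp_all add: B_def)
    thus ?thesis unfolding Psi_def B_def[symmetric] using that by simp
  qed
  have Psi_index: "Psi $$ (i, j) = (\<Sum>k<M + Nt. cnj (A k i) * A k j)" if ij: "i < Nt" "j < Nt" for i j
  proof -
    have "bt * br * NR \<ge> 0" "bd * NH \<ge> 0" using assms by auto
    hence sq: "complex_of_real (sqrt (bt * br * NR)) * complex_of_real (sqrt (bt * br * NR)) = complex_of_real (bt * br * NR)"
      "complex_of_real (sqrt (bd * NH)) * complex_of_real (sqrt (bd * NH)) = complex_of_real (bd * NH)"
      by (simp_all only: of_real_mult[symmetric] real_sqrt_mult_self abs_of_nonneg)
    have "(\<Sum>k<M. cnj (A k i) * A k j) = (\<Sum>k<M. complex_of_real (bt * br * NR) * (cnj (Tm $$ (k, i)) * Tm $$ (k, j)))"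
    proof (intro sum.cong refl)
      fix k assume "k \<in> {..<M}"
      hence "cnj (A k i) * A k j =
        (complex_of_real (sqrt (bt * br * NR)) * complex_of_real (sqrt (bt * br * NR))) * (cnj (cis (phase k)) * cis (phase k)) *
        (cnj (Tm $$ (k, i)) * Tm $$ (k, j))"
        unfolding A_def by (simp only: lessThan_iff if_True complex_cnj_mult complex_cnj_complex_of_real mult_ac)
      \<comment> \<open>The phases are unimodular, which is why \<open>Psi\<close> does not depend
        on \<open>Phi\<close>.\<close>
      also have "cnj (cis (phase k)) * cis (phase k) = 1" by (simp add: cis_cnj cis_mult)
      finally show "cnj (A k i) * A k j = complex_of_real (bt * br * NR) * (cnj (Tm $$ (k, i)) * Tm $$ (k, j))"
        unfolding sq by simp
    qed
    moreover have "(\<Sum>k<Nt. cnj (A (M + k) i) * A (M + k) j) = (if i = j then complex_of_real (bd * NH) else 0)"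
    proof -
      have "(\<Sum>k<Nt. cnj (A (M + k) i) * A (M + k) j) =
        (\<Sum>k<Nt. if k = i then (if i = j then complex_of_real (bd * NH) else 0) else 0)"
        unfolding sq(2)[symmetric] by (intro sum.cong refl) (auto simp: A_def)
      thus ?thesis using ij by simp
    qed
    ultimately show ?thesis
      by (simp add: Psi_index'[OF ij] sum_lessThan_add sum_distrib_left)
  qed
  \<comment> \<open>\<open>Psi\<close> is a nonnegative multiple of a Gram matrix plus
    \<open>bd * NH\<close> times the identity; as \<open>bd * NH > 0\<close>, its principal minors
    are bounded below by a positive number and the inverses exist.\<close>
  have det: "Determinant.det (principal Psi Q) \<noteq> 0" if Q: "Q \<subseteq> {..<Nt}" for Q
  proof -
    have "finite Q" using Q finite_subset by auto
    hence "(bd * NH) ^ card Q \<le> Re (pdet Q (\<lambda>i j. (if i = j then complex_of_real (bd * NH) else 0) +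
      complex_of_real (bt * br * NR) * (\<Sum>k<M. cnj (Tm $$ (k, i)) * Tm $$ (k, j))))"
      by (rule Re_pdet_scalar_add_gram_ge) (use assms in auto)
    also have "pdet Q (\<lambda>i j. (if i = j then complex_of_real (bd * NH) else 0) +
      complex_of_real (bt * br * NR) * (\<Sum>k<M. cnj (Tm $$ (k, i)) * Tm $$ (k, j))) = Determinant.det (principal Psi Q)"
      unfolding det_principal[OF Psi Q] using Q by (intro pdet_cong Psi_index'[symmetric]) auto
    finally have "(bd * NH) ^ card Q \<le> Re (Determinant.det (principal Psi Q))" .
    moreover have "(bd * NH) ^ card Q > 0" using assms by simp
    ultimately show ?thesis by auto
  qed
  have "M > 0" "rhob \<ge> 0" using assms by (auto simp: M_def rhob_def)
  interpret white_matrix "gauss_mat Nr M \<Otimes>\<^sub>M gauss_mat Nr Nt"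
    "\<lambda>(r, k) w. if k < M then fst w (r, k) else snd w (r, k - M)" Nr "M + Nt"
    by (rule white_matrix_gauss_mat_pair) fact+
  show ?thesis
    unfolding Sigma_def case_prod_unfold
    by (rule expectation_log_det_le[where A = A])
       (use \<open>rhob \<ge> 0\<close> G Gbar Psi Psi_index det G_index in auto)
qed

end
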